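(* Let $\mathfrak{s}$ be a solvable Lie algebra with abelian nilradical $\mathfrak{n}$, and let $S$ be the simply connected Lie group with Lie algebra $\mathfrak{s}$. Assume that $S$ admits a solvsoliton $g$. If $\mathfrak{s}=\mathfrak{a}\oplus\mathfrak{n}$ is orthogonal with respect to $g$, then the solvsoliton $g$ is a global maximum for the functional $F=\frac{\operatorname{scal}^2}{|\operatorname{Ric}|^2}$ restricted to the set of all left-invariant metrics on $S$ such that $\mathfrak{a}\perp\mathfrak{n}$. Moreover, any other global maximum $g'$ for $F$ on this set is also a solvsoliton (i.e. $g'=c\,\varphi^*g$ for some $c>0$ and $\varphi\in\operatorname{Aut}(S)$).
   Context: Lie algebras are real and finite-dimensional, and left-invariant metrics are Riemannian; a left-invariant metric on $S$ is identified with the inner product it induces on $\mathfrak{s}$, and orthogonality of subspaces of $\mathfrak{s}$ refers to that inner product. Thus $\mathfrak{a}$ is the orthogonal complement of $\mathfrak{n}$ in $\mathfrak{s}$ with respect to $g$, and it is kept fixed. A left-invariant metric on a simply connected solvable Lie group $S$ with Lie algebra $\mathfrak{s}$ is called a solvsoliton if its Ricci operator satisfies $\operatorname{Ric}=cI+D$ for some $c\in\mathbb{R}$ and some derivation $D\in\operatorname{Der}(\mathfrak{s})$. The Ricci pinching functional $F$ assigns to a left-invariant metric the number $F=\operatorname{scal}^2/|\operatorname{Ric}|^2$, where $\operatorname{Ric}$ is its Ricci operator, $\operatorname{scal}=\operatorname{tr}\operatorname{Ric}$ its scalar curvature, and $|\operatorname{Ric}|^2=\operatorname{tr}(\operatorname{Ric}^2)$.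 The nilradical of $\mathfrak{s}$ is its maximal nilpotent ideal. $\operatorname{Aut}(S)$ is the group of Lie group automorphisms of $S$.
   Formalization: The solvsoliton g is assumed not to be Ricci-flat, and F is considered only on metrics with Ric ≠ 0, since F = scal²/|Ric|² is 0/0 when Ric = 0 (for example the flat solvsoliton on the universal cover of E(2), where the claim fails). *)

theory Defs
  imports "HOL-Analysis.Analysis"
begin

section \<open>Real finite-dimensional Lie algebras\<close>

text \<open>
  The type \<open>'s :: euclidean_space\<close> serves as a finite-dimensional real vector space carrying a
  Lie bracket \<open>br\<close>.  Its built-in inner product \<open>inner\<close> plays no geometric role: the metrics below
  are arbitrary inner products \<open>g :: 's \<Rightarrow> 's \<Rightarrow> real\<close>, and \<open>inner\<close> only enters through the
  coordinates with respect to \<open>Basis\<close> that are used to write down a trace.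
\<close>

definition lie_algebra :: "('s::euclidean_space \<Rightarrow> 's \<Rightarrow> 's) \<Rightarrow> bool" where
  "lie_algebra br \<longleftrightarrow>
     bilinear br \<and>
     (\<forall>x. br x x = 0) \<and>
     (\<forall>x y z. br x (br y z) + br y (br z x) + br z (br x y) = 0)"

definition bracket_span :: "('s::euclidean_space \<Rightarrow> 's \<Rightarrow> 's) \<Rightarrow> 's set \<Rightarrow> 's set \<Rightarrow> 's set" where
  "bracket_span br A B = span {br x y | x y. x \<in> A \<and> y \<in> B}"

primrec derived_series :: "('s::euclidean_space \<Rightarrow> 's \<Rightarrow> 's) \<Rightarrow> nat \<Rightarrow> 's set" where
  "derived_series br 0 = UNIV"
| "derived_series br (Suc k) = bracket_span br (derived_series br k) (derived_series br k)"

definition solvable_lie :: "('s::euclidean_space \<Rightarrow> 's \<Rightarrow> 's) \<Rightarrow> bool" where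
  "solvable_lie br \<longleftrightarrow> (\<exists>k. derived_series br k = {0})"

definition lie_ideal :: "('s::euclidean_space \<Rightarrow> 's \<Rightarrow> 's) \<Rightarrow> 's set \<Rightarrow> bool" where
  "lie_ideal br I \<longleftrightarrow> subspace I \<and> (\<forall>x. \<forall>y\<in>I. br x y \<in> I)"

primrec lower_central_series ::
    "('s::euclidean_space \<Rightarrow> 's \<Rightarrow> 's) \<Rightarrow> 's set \<Rightarrow> nat \<Rightarrow> 's set" where
  "lower_central_series br I 0 = I"
| "lower_central_series br I (Suc k) = bracket_span br I (lower_central_series br I k)"

definition nilpotent_ideal :: "('s::euclidean_space \<Rightarrow> 's \<Rightarrow> 's) \<Rightarrow> 's set \<Rightarrow> bool" where
  "nilpotent_ideal br I \<longleftrightarrow> lie_ideal br I \<and> (\<exists>k. lower_central_series br I k = {0})"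

definition is_nilradical :: "('s::euclidean_space \<Rightarrow> 's \<Rightarrow> 's) \<Rightarrow> 's set \<Rightarrow> bool" where
  "is_nilradical br n \<longleftrightarrow> nilpotent_ideal br n \<and> (\<forall>m. nilpotent_ideal br m \<longrightarrow> m \<subseteq> n)"

definition abelian_on :: "('s::euclidean_space \<Rightarrow> 's \<Rightarrow> 's) \<Rightarrow> 's set \<Rightarrow> bool" where
  "abelian_on br I \<longleftrightarrow> (\<forall>x\<in>I. \<forall>y\<in>I. br x y = 0)"

definition lie_derivation :: "('s::euclidean_space \<Rightarrow> 's \<Rightarrow> 's) \<Rightarrow> ('s \<Rightarrow> 's) \<Rightarrow> bool" where
  "lie_derivation br D \<longleftrightarrow> linear D \<and> (\<forall>x y. D (br x y) = br (D x) y + br x (D y))"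

text \<open>
  For the simply connected group \<open>S\<close> of the Lie algebra, taking the differential at the identity
  identifies \<open>Aut(S)\<close> with the following linear automorphisms.
\<close>

definition lie_automorphism :: "('s::euclidean_space \<Rightarrow> 's \<Rightarrow> 's) \<Rightarrow> ('s \<Rightarrow> 's) \<Rightarrow> bool" where
  "lie_automorphism br \<phi> \<longleftrightarrow> linear \<phi> \<and> bij \<phi> \<and> (\<forall>x y. \<phi> (br x y) = br (\<phi> x) (\<phi> y))"

section \<open>Left-invariant metrics and their curvature\<close>

text \<open>
  A left-invariant metric on \<open>S\<close> is given by the inner product it induces on the Lie algebra; all
  tensors below are evaluated on left-invariant vector fields, i.e. on elements of the Lie algebra.
\<close>

definition inner_product :: "('s::euclidean_space \<Rightarrow> 's \<Rightarrow> real) \<Rightarrow> bool" where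
  "inner_product g \<longleftrightarrow>
     bilinear g \<and> (\<forall>x y. g x y = g y x) \<and> (\<forall>x. x \<noteq> 0 \<longrightarrow> g x x > 0)"

definition orthogonal_wrt ::
    "('s::euclidean_space \<Rightarrow> 's \<Rightarrow> real) \<Rightarrow> 's set \<Rightarrow> 's set \<Rightarrow> bool" where
  "orthogonal_wrt g A B \<longleftrightarrow> (\<forall>x\<in>A. \<forall>y\<in>B. g x y = 0)"

definition orthogonal_complement ::
    "('s::euclidean_space \<Rightarrow> 's \<Rightarrow> real) \<Rightarrow> 's set \<Rightarrow> 's set" where
  "orthogonal_complement g B = {x. \<forall>y\<in>B. g x y = 0}"

text \<open>The value of this sum on a linear map does not depend on the chosen basis.\<close>

definition lin_trace :: "('s::euclidean_space \<Rightarrow> 's) \<Rightarrow> real" where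
  "lin_trace f = (\<Sum>b\<in>Basis. f b \<bullet> b)"

text \<open>
  Koszul formula; on left-invariant fields the three terms that differentiate the (constant)
  inner products vanish.
\<close>

definition levi_civita ::
    "('s::euclidean_space \<Rightarrow> 's \<Rightarrow> 's) \<Rightarrow> ('s \<Rightarrow> 's \<Rightarrow> real) \<Rightarrow> 's \<Rightarrow> 's \<Rightarrow> 's" where
  "levi_civita br g x y =
     (THE u. \<forall>z. 2 * g u z = g (br x y) z - g (br y z) x + g (br z x) y)"

definition curvature ::
    "('s::euclidean_space \<Rightarrow> 's \<Rightarrow> 's) \<Rightarrow> ('s \<Rightarrow> 's \<Rightarrow> real) \<Rightarrow> 's \<Rightarrow> 's \<Rightarrow> 's \<Rightarrow> 's" where
  "curvature br g x y z =
     levi_civita br g x (levi_civita br g y z)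
     - levi_civita br g y (levi_civita br g x z)
     - levi_civita br g (br x y) z"

definition ricci_tensor ::
    "('s::euclidean_space \<Rightarrow> 's \<Rightarrow> 's) \<Rightarrow> ('s \<Rightarrow> 's \<Rightarrow> real) \<Rightarrow> 's \<Rightarrow> 's \<Rightarrow> real" where
  "ricci_tensor br g y z = lin_trace (\<lambda>x. curvature br g x y z)"

definition ricci_operator ::
    "('s::euclidean_space \<Rightarrow> 's \<Rightarrow> 's) \<Rightarrow> ('s \<Rightarrow> 's \<Rightarrow> real) \<Rightarrow> 's \<Rightarrow> 's" where
  "ricci_operator br g y = (THE u. \<forall>z. g u z = ricci_tensor br g y z)"

definition scalar_curvature ::
    "('s::euclidean_space \<Rightarrow> 's \<Rightarrow> 's) \<Rightarrow> ('s \<Rightarrow> 's \<Rightarrow> real) \<Rightarrow> real" where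
  "scalar_curvature br g = lin_trace (ricci_operator br g)"

definition ricci_norm_sq ::
    "('s::euclidean_space \<Rightarrow> 's \<Rightarrow> 's) \<Rightarrow> ('s \<Rightarrow> 's \<Rightarrow> real) \<Rightarrow> real" where
  "ricci_norm_sq br g = lin_trace (ricci_operator br g \<circ> ricci_operator br g)"

definition ricci_pinching ::
    "('s::euclidean_space \<Rightarrow> 's \<Rightarrow> 's) \<Rightarrow> ('s \<Rightarrow> 's \<Rightarrow> real) \<Rightarrow> real" where
  "ricci_pinching br g = (scalar_curvature br g)\<^sup>2 / ricci_norm_sq br g"

text \<open>
  \<open>ricci_pinching\<close> is mathematically undefined (\<open>0/0\<close>) exactly when the Ricci operator vanishes
  (for homogeneous spaces: exactly for flat metrics), so its domain is the set of metrics with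
  \<open>\<not> ricci_flat br g\<close>.
\<close>

definition ricci_flat :: "('s::euclidean_space \<Rightarrow> 's \<Rightarrow> 's) \<Rightarrow> ('s \<Rightarrow> 's \<Rightarrow> real) \<Rightarrow> bool" where
  "ricci_flat br g \<longleftrightarrow> (\<forall>x. ricci_operator br g x = 0)"

definition solvsoliton :: "('s::euclidean_space \<Rightarrow> 's \<Rightarrow> 's) \<Rightarrow> ('s \<Rightarrow> 's \<Rightarrow> real) \<Rightarrow> bool" where
  "solvsoliton br g \<longleftrightarrow>
     inner_product g \<and>
     (\<exists>c D. lie_derivation br D \<and> (\<forall>x. ricci_operator br g x = c *\<^sub>R x + D x))"

text \<open>The metrics with \<open>A \<perp> B\<close> that lie in the domain of \<open>ricci_pinching br\<close>.\<close>

definition metrics_with_orthogonal ::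
    "('s::euclidean_space \<Rightarrow> 's \<Rightarrow> 's) \<Rightarrow> 's set \<Rightarrow> 's set \<Rightarrow> ('s \<Rightarrow> 's \<Rightarrow> real) set" where
  "metrics_with_orthogonal br A B =
     {g. inner_product g \<and> orthogonal_wrt g A B \<and> \<not> ricci_flat br g}"

end

theory Submission
  imports Defs
begin

text \<open>
  Every metric with \<open>\<aa> \<perp> n\<close> has \<open>scal = - \<Sum> (q\<^sub>i + \<tau>\<^sub>i\<^sup>2)\<close> and
  \<open>|Ric|\<^sup>2 = \<Sum> q\<^sub>i (q\<^sub>i + \<tau>\<^sub>i\<^sup>2) + |C|\<^sup>2 / 4\<close>, once \<open>[\<aa>, \<aa>] = 0\<close> is known.  Here \<open>T x\<close> is
  \<open>ad x\<close> restricted to \<open>n\<close>, the \<open>q\<^sub>i\<close> are the eigenvalues of \<open>Q x x = |sym (T x)|\<^sup>2\<close> on \<open>\<aa>\<close>, the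
  \<open>\<tau>\<^sub>i\<close> are the traces of the operators \<open>T a\<^sub>i\<close> of an eigenbasis, and \<open>C = \<Sum> [T a\<^sub>i, (T a\<^sub>i)\<^sup>t]\<close>.
  By Cauchy-Schwarz, \<open>F \<le> dim \<aa> + \<Sum> \<tau>\<^sub>i\<^sup>2 / q\<^sub>i\<close>; the sum on the right is the squared norm of the linear
  form \<open>tr (T x)\<close> dual to \<open>Q\<close>, so the bound decreases when \<open>Q\<close> grows.

  For a solvsoliton, a trace computation with the derivation gives \<open>[\<aa>, \<aa>] = 0\<close>, \<open>C = 0\<close> (hence all
  \<open>T x\<close> are normal) and \<open>Q = - c g\<close> on \<open>\<aa>\<close>.  The Cauchy-Schwarz bound is then attained, and \<open>Q\<close> is
  minimal among all metrics because a normal operator minimises the norm in its conjugacy class.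
  Equality for \<open>g'\<close> forces \<open>C' = 0\<close>, hence \<open>Q' = Q\<close> and \<open>g' = \<kappa> g\<close> on \<open>\<aa>\<close>, and the operators \<open>T x\<close> commute
  with the operator \<open>P\<close> on \<open>n\<close> relating \<open>g'\<close> to \<open>g\<close>.  The automorphism is the identity on \<open>\<aa>\<close> and
  \<open>(P / \<kappa>)\<^sup>1\<^sup>/\<^sup>2\<close> on \<open>n\<close>.
\<close>

section \<open>Inner products, adjoints and traces\<close>

locale inner_prod =
  fixes g :: "'s::euclidean_space \<Rightarrow> 's \<Rightarrow> real"
  assumes inner_product: "inner_product g"
begin

sublocale g: bounded_bilinear g
  using inner_product by (auto simp: inner_product_def bilinear_conv_bounded_bilinear)

lemma commute: "g x y = g y x"
  using inner_product by (auto simp: inner_product_def)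

lemma pos: "x \<noteq> 0 \<Longrightarrow> g x x > 0"
  using inner_product by (auto simp: inner_product_def)

lemma nonneg: "g x x \<ge> 0"
  using pos[of x] by (cases "x = 0") (auto simp: g.zero_left)

lemma eq_0_iff: "g x x = 0 \<longleftrightarrow> x = 0"
  using pos[of x] by (cases "x = 0") (auto simp: g.zero_left)

lemma eqI: "(\<And>z. g x z = g y z) \<Longrightarrow> x = y"
  using eq_0_iff[of "x - y"] by (simp add: g.diff_left)

section \<open>Orthonormal bases and simultaneous diagonalisation\<close>

definition onb :: "'s set \<Rightarrow> 's set \<Rightarrow> bool" where
  "onb V B \<longleftrightarrow> finite B \<and> span B = V \<and> (\<forall>b\<in>B. \<forall>c\<in>B. g b c = (if b = c then 1 else 0))"

text \<open>A maximiser \<open>w\<close> of the Rayleigh quotient \<open>h x x / g x x\<close> on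
  \<open>V\<close> is an eigenvector of \<open>h\<close> relative to \<open>g\<close>, so
  \<open>h\<close> splits along its \<open>g\<close>-complement \<open>V'\<close> and induction on
  the dimension applies to \<open>V'\<close>.\<close>

lemma exists_diagonal_onb:
  assumes h: "bilinear h" "\<And>x y. h x y = h y x" and V: "subspace V"
  shows "\<exists>B. onb V B \<and> (\<forall>b\<in>B. \<forall>c\<in>B. b \<noteq> c \<longrightarrow> h b c = (0::real))"
  using V
proof (induction "dim V" arbitrary: V rule: less_induct)
  case less
  interpret h: bounded_bilinear h using h(1) by (simp add: bilinear_conv_bounded_bilinear)
  show ?case
  proof (cases "V = {0}")
    case True
    then show ?thesis by (intro exI[of _ "{}"]) (auto simp: onb_def)
  next
    case False
    \<comment> \<open>The quotient is invariant under scaling, so its maximum on \<open>V\<close>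
      can be sought on the compact unit sphere of the ambient norm.\<close>
    let ?S = "V \<inter> sphere 0 1" and ?q = "\<lambda>x. h x x / g x x"
    obtain v where v: "v \<in> V" "v \<noteq> 0"
      using False less.prems subspace_0 by blast
    then have "(1 / norm v) *\<^sub>R v \<in> ?S"
      using less.prems by (simp add: subspace_scale)
    then have ne: "?S \<noteq> {}" by blast
    have cpt: "compact ?S"
      using closed_subspace[OF less.prems] by (intro closed_Int_compact) auto
    have cont: "continuous_on ?S ?q"
      by (intro continuous_on_divide h.continuous_on g.continuous_on continuous_on_id)
        (auto simp: eq_0_iff)
    obtain w where w: "w \<in> ?S" "\<And>x. x \<in> ?S \<Longrightarrow> ?q x \<le> ?q w"
      using continuous_attains_sup[OF cpt ne cont] by blast
    define \<mu> where "\<mu> = ?q w"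
    have w0: "w \<noteq> 0" using w(1) by auto
    have le: "h x x \<le> \<mu> * g x x" if "x \<in> V" for x
    proof (cases "x = 0")
      case False
      let ?y = "(1 / norm x) *\<^sub>R x"
      have "?q ?y \<le> \<mu>"
        unfolding \<mu>_def using that False less.prems
        by (intro w(2)) (simp add: subspace_scale)
      moreover have "?q ?y = ?q x"
        using False by (simp add: h.scaleR_left h.scaleR_right g.scaleR_left g.scaleR_right)
      ultimately show ?thesis using pos[OF False] by (simp add: pos_divide_le_eq)
    qed (simp add: h.zero_left g.zero_left)
    define u where "u = (1 / sqrt (g w w)) *\<^sub>R w"
    have gw: "g w w > 0" using pos[OF w0] .
    have gu: "g u u = 1"
      using gw by (simp add: u_def g.scaleR_left g.scaleR_right)
    have hu: "h u u = \<mu>"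
      using gw by (simp add: u_def h.scaleR_left h.scaleR_right \<mu>_def)
    have uV: "u \<in> V" using w(1) less.prems by (simp add: u_def subspace_scale)
    define V' where "V' = {x \<in> V. g u x = 0}"
    have sub: "subspace V'"
      using less.prems unfolding V'_def subspace_def
      by (auto simp: g.add_right g.scaleR_right g.zero_right)
    have "u \<notin> V'" using gu by (simp add: V'_def)
    then have "V' \<subset> V" using uV by (auto simp: V'_def)
    then have "dim V' < dim V"
      using less.prems sub by (metis dim_psubset span_eq_iff)
    from less.hyps[OF this sub] obtain B where
      B: "onb V' B" "\<forall>b\<in>B. \<forall>c\<in>B. b \<noteq> c \<longrightarrow> h b c = 0" by blast
    have BV: "b \<in> V'" if "b \<in> B" for b
      using B(1) span_base[OF that] by (simp add: onb_def)
    \<comment> \<open>First-order condition at the maximiser: otherwise a small multiple of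
      \<open>x\<close> added to \<open>u\<close> would raise the quotient above \<mu>.\<close>
    have hux: "h u x = 0" if x: "x \<in> V'" for x
    proof (rule ccontr)
      assume ne: "h u x \<noteq> 0"
      have xV: "x \<in> V" and gx: "g u x = 0" using x by (auto simp: V'_def)
      define k where "k = \<mu> * g x x - h x x"
      have *: "2 * t * h u x \<le> t\<^sup>2 * k" for t
      proof -
        have "u + t *\<^sub>R x \<in> V"
          using uV xV less.prems by (simp add: subspace_add subspace_scale)
        from le[OF this] have "\<mu> + 2 * t * h u x + t\<^sup>2 * h x x \<le> \<mu> * (1 + t\<^sup>2 * g x x)"
          using gx h(2)[of x u] commute[of x u]
          by (simp add: h.add_left h.add_right h.scaleR_left h.scaleR_right g.add_left g.add_right
              g.scaleR_left g.scaleR_right gu hu power2_eq_square algebra_simps)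
        then show ?thesis by (simp add: k_def algebra_simps)
      qed
      have k0: "k \<ge> 0" using le[OF xV] by (simp add: k_def)
      \<comment> \<open>The inequality \<open>*\<close> fails at this \<open>t\<close>; the summand
        \<open>1\<close> keeps the denominator positive when \<open>k = 0\<close>.\<close>
      define t where "t = h u x / (k + 1)"
      have "h u x = (k + 1) * t" using k0 by (simp add: t_def)
      with *[of t] have "t\<^sup>2 * (k + 2) \<le> 0"
        by (simp add: power2_eq_square algebra_simps)
      moreover have "t\<^sup>2 > 0" using ne k0 by (simp add: t_def)
      ultimately show False using k0 by (simp add: mult_le_0_iff)
    qed
    have "onb V (insert u B)"
      unfolding onb_def
    proof (intro conjI)
      show "finite (insert u B)" using B(1) by (simp add: onb_def)
      have "x \<in> span (insert u B)" if "x \<in> V" for x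
      proof -
        have "x - g u x *\<^sub>R u \<in> V'"
          using that uV less.prems gu
          by (simp add: V'_def subspace_diff subspace_scale g.diff_right g.scaleR_right)
        then have "x - g u x *\<^sub>R u \<in> span B" using B(1) by (simp add: onb_def)
        then show ?thesis by (auto simp: span_insert)
      qed
      moreover have "span (insert u B) \<subseteq> V"
        using uV BV less.prems by (intro span_minimal) (auto simp: V'_def)
      ultimately show "span (insert u B) = V" by blast
      have "g u b = 0" "g b u = 0" if "b \<in> B" for b
        using BV[OF that] commute[of u b] by (auto simp: V'_def)
      then show "\<forall>b\<in>insert u B. \<forall>c\<in>insert u B. g b c = (if b = c then 1 else 0)"
        using B(1) gu by (auto simp: onb_def)
    qed
    moreover have "h u b = 0" "h b u = 0" if "b \<in> B" for b
      using hux[OF BV[OF that]] h(2)[of u b] by auto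
    then have "\<forall>b\<in>insert u B. \<forall>c\<in>insert u B. b \<noteq> c \<longrightarrow> h b c = 0"
      using B(2) by auto
    ultimately show ?thesis by blast
  qed
qed

lemma exists_onb: "subspace V \<Longrightarrow> \<exists>B. onb V B"
  using exists_diagonal_onb[of g V] inner_product by (auto simp: inner_product_def)

lemma onb_expand:
  assumes "onb V B" "x \<in> V"
  shows "(\<Sum>b\<in>B. g x b *\<^sub>R b) = x"
proof -
  let ?f = "\<lambda>x. \<Sum>b\<in>B. g x b *\<^sub>R b"
  have "x \<in> span B" using assms by (simp add: onb_def)
  then show ?thesis
  proof (induction rule: span_induct_alt)
    case base show ?case by (simp add: g.zero_left)
  next
    case (step c b y)
    have "?f (c *\<^sub>R b + y) = c *\<^sub>R ?f b + ?f y"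
      by (simp add: g.add_left g.scaleR_left sum.distrib scaleR_left_distrib scaleR_sum_right)
    moreover have "?f b = (\<Sum>c\<in>B. if b = c then c else 0)"
      using assms(1) step(1) by (intro sum.cong) (auto simp: onb_def)
    then have "?f b = b" using assms(1) step(1) by (simp add: onb_def)
    ultimately show ?case using step by simp
  qed
qed

lemma onb_parseval: "onb V B \<Longrightarrow> x \<in> V \<Longrightarrow> g x y = (\<Sum>b\<in>B. g x b * g b y)"
  using arg_cong[OF onb_expand, of V B x "\<lambda>z. g z y"]
  by (simp add: g.sum_left g.scaleR_left)

lemma onb_unique:
  assumes "onb UNIV B" "\<And>b. b \<in> B \<Longrightarrow> g x b = g y b"
  shows "x = y"
proof -
  have "x = (\<Sum>b\<in>B. g x b *\<^sub>R b)" by (simp add: onb_expand[OF assms(1)])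
  also have "\<dots> = (\<Sum>b\<in>B. g y b *\<^sub>R b)" by (intro sum.cong) (auto simp: assms(2))
  also have "\<dots> = y" by (simp add: onb_expand[OF assms(1)])
  finally show ?thesis .
qed

text \<open>Basis independence of the trace: write each \<open>f b\<close> in coordinates with
  respect to \<open>Basis\<close> and exchange the two sums.\<close>

lemma lin_trace_onb:
  assumes "onb UNIV B" "linear f"
  shows "lin_trace f = (\<Sum>b\<in>B. g (f b) b)"
proof -
  have "g (f b) b = (\<Sum>i\<in>Basis. (f b \<bullet> i) * g i b)" for b
    using arg_cong[OF euclidean_representation[of "f b"], of "\<lambda>z. g z b"]
    by (simp add: g.sum_left g.scaleR_left)
  then have "(\<Sum>b\<in>B. g (f b) b) = (\<Sum>i\<in>Basis. \<Sum>b\<in>B. (f b \<bullet> i) * g i b)"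
    by (simp add: sum.swap[of _ B])
  also have "\<dots> = (\<Sum>i\<in>Basis. f (\<Sum>b\<in>B. g i b *\<^sub>R b) \<bullet> i)"
    by (simp add: linear_sum[OF assms(2)] linear_cmul[OF assms(2)] inner_sum_left mult.commute)
  finally show ?thesis by (simp add: lin_trace_def onb_expand[OF assms(1)])
qed

end

text \<open>Operators are bundled as bounded linear maps so that composition is a bilinear product.\<close>

lemmas comp_simps = bounded_bilinear.add_left[OF bounded_bilinear_blinfun_compose]
  bounded_bilinear.add_right[OF bounded_bilinear_blinfun_compose]
  bounded_bilinear.diff_left[OF bounded_bilinear_blinfun_compose]
  bounded_bilinear.diff_right[OF bounded_bilinear_blinfun_compose]
  bounded_bilinear.minus_left[OF bounded_bilinear_blinfun_compose]
  bounded_bilinear.minus_right[OF bounded_bilinear_blinfun_compose]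
  bounded_bilinear.scaleR_left[OF bounded_bilinear_blinfun_compose]
  bounded_bilinear.scaleR_right[OF bounded_bilinear_blinfun_compose]
  bounded_bilinear.sum_left[OF bounded_bilinear_blinfun_compose]
  bounded_bilinear.sum_right[OF bounded_bilinear_blinfun_compose]

lemma comp_assoc: "(a o\<^sub>L b) o\<^sub>L c = a o\<^sub>L (b o\<^sub>L c)"
  by (rule blinfun_eqI) simp

lemma Blinfun_linear: "linear f \<Longrightarrow> blinfun_apply (Blinfun f) = (f :: 's::euclidean_space \<Rightarrow> 't::real_normed_vector)"
  by (simp add: bounded_linear_Blinfun_apply linear_conv_bounded_linear)

lemma linear_blinfun: "linear (blinfun_apply f)"
  by (simp add: blinfun.bounded_linear_right bounded_linear.linear)

definition tr :: "('s::euclidean_space \<Rightarrow>\<^sub>L 's) \<Rightarrow> real" where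
  "tr f = lin_trace (blinfun_apply f)"

lemma linear_tr: "linear tr"
  by (rule linearI)
    (auto simp: tr_def lin_trace_def blinfun.bilinear_simps inner_add_left sum.distrib sum_distrib_left)

lemmas tr_simps = linear_add[OF linear_tr] linear_diff[OF linear_tr] linear_cmul[OF linear_tr]
  linear_sum[OF linear_tr] linear_neg[OF linear_tr] linear_0[OF linear_tr]

lemma tr_commute:
  fixes a b :: "'s::euclidean_space \<Rightarrow>\<^sub>L 's"
  shows "tr (a o\<^sub>L b) = tr (b o\<^sub>L a)"
proof -
  have *: "x \<bullet> y = (\<Sum>i\<in>Basis. (x \<bullet> i) * (i \<bullet> y))" for x y :: 's
    by (subst euclidean_inner) (simp add: inner_commute)
  have entries: "tr (a o\<^sub>L b) = (\<Sum>i\<in>Basis. \<Sum>j\<in>Basis. (a j \<bullet> i) * (b i \<bullet> j))" for a b :: "'s \<Rightarrow>\<^sub>L 's"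
  proof -
    have "a (b i) \<bullet> i = (\<Sum>j\<in>Basis. (a j \<bullet> i) * (b i \<bullet> j))" for i
      using arg_cong[OF euclidean_representation[of "b i"], of "\<lambda>z. a z \<bullet> i"]
      by (simp add: blinfun.sum_right blinfun.scaleR_right inner_sum_left mult.commute)
    then show ?thesis by (simp add: tr_def lin_trace_def)
  qed
  show ?thesis unfolding entries by (subst sum.swap) (simp add: mult.commute)
qed

section \<open>Adjoints and the Hilbert-Schmidt norm\<close>

context inner_prod begin

lemma tr_onb: "onb UNIV B \<Longrightarrow> tr f = (\<Sum>b\<in>B. g (blinfun_apply f b) b)"
  by (simp add: tr_def lin_trace_onb linear_blinfun)

text \<open>The adjoint is taken with respect to \<open>g\<close>, not to the built-in inner
  product; by \<open>adjI\<close> it does not depend on the orthonormal basis selected here.\<close>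

definition adj :: "('s \<Rightarrow>\<^sub>L 's) \<Rightarrow> 's \<Rightarrow>\<^sub>L 's" where
  "adj f = Blinfun (\<lambda>y. \<Sum>b\<in>(SOME B. onb UNIV B). g y (f b) *\<^sub>R b)"

lemma adj: "g (adj f y) x = g y (blinfun_apply f x)"
proof -
  define B where "B = (SOME B. onb UNIV B)"
  have B: "onb UNIV B" unfolding B_def using someI_ex[OF exists_onb[of UNIV]] by simp
  have "adj f y = (\<Sum>b\<in>B. g y (f b) *\<^sub>R b)"
    unfolding adj_def B_def[symmetric]
    by (subst Blinfun_linear)
      (auto intro!: linearI simp: g.add_left g.scaleR_left sum.distrib scaleR_left_distrib scaleR_sum_right)
  then have "g (adj f y) x = g y (f (\<Sum>b\<in>B. g x b *\<^sub>R b))"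
    by (simp add: g.sum_left g.sum_right g.scaleR_left g.scaleR_right blinfun.sum_right
        blinfun.scaleR_right commute[of x] mult.commute)
  then show ?thesis by (simp add: onb_expand[OF B])
qed

lemma adj': "g x (adj f y) = g (blinfun_apply f x) y"
  using adj[of f y x] commute by metis

lemma adjI: "(\<And>x y. g (blinfun_apply h y) x = g y (blinfun_apply f x)) \<Longrightarrow> adj f = h"
  by (intro blinfun_eqI eqI) (simp add: adj)

lemma adj_adj[simp]: "adj (adj f) = f"
  by (rule adjI) (simp add: adj')

lemma adj_comp: "adj (a o\<^sub>L b) = adj b o\<^sub>L adj a"
  by (rule adjI) (simp add: adj)

lemma linear_adj: "linear adj"
  by (intro linearI adjI) (simp_all add: blinfun.bilinear_simps g.add_left g.add_right
      g.scaleR_left g.scaleR_right adj)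

lemmas adj_simps = linear_add[OF linear_adj] linear_diff[OF linear_adj] linear_cmul[OF linear_adj]
  linear_sum[OF linear_adj] linear_neg[OF linear_adj] linear_0[OF linear_adj]

lemma tr_adj: "tr (adj f) = tr f"
proof -
  obtain B where B: "onb UNIV B" using exists_onb[of UNIV] by auto
  show ?thesis unfolding tr_onb[OF B] adj by (simp add: commute)
qed

text \<open>This is the squared Hilbert-Schmidt norm of \<open>f\<close> for \<open>g\<close>; its
  definiteness is what turns trace identities into vanishing operators below.\<close>

lemma tr_adj_self: "onb UNIV B \<Longrightarrow> tr (f o\<^sub>L adj f) = (\<Sum>b\<in>B. g (blinfun_apply f b) (blinfun_apply f b))"
  unfolding tr_commute[of f] by (simp add: tr_onb[of B] adj)

lemma tr_adj_self_nonneg: "tr (f o\<^sub>L adj f) \<ge> 0"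
proof -
  obtain B where B: "onb UNIV B" using exists_onb[of UNIV] by auto
  show ?thesis unfolding tr_adj_self[OF B] by (intro sum_nonneg nonneg)
qed

lemma tr_adj_self_eq_0: "tr (f o\<^sub>L adj f) = 0 \<Longrightarrow> f = 0"
proof -
  assume *: "tr (f o\<^sub>L adj f) = 0"
  obtain B where B: "onb UNIV B" using exists_onb[of UNIV] by auto
  then have "finite B" by (simp add: onb_def)
  then have fb: "f b = 0" if "b \<in> B" for b
    using * that by (simp add: tr_adj_self[OF B] sum_nonneg_eq_0_iff nonneg eq_0_iff)
  show "f = 0"
  proof (rule blinfun_eqI)
    fix x
    have "f x = f (\<Sum>b\<in>B. g x b *\<^sub>R b)" by (simp add: onb_expand[OF B])
    then show "f x = blinfun_apply 0 x" by (simp add: blinfun.sum_right blinfun.scaleR_right fb)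
  qed
qed

end

section \<open>Nilpotency from vanishing traces\<close>

primrec opow :: "('s::euclidean_space \<Rightarrow>\<^sub>L 's) \<Rightarrow> nat \<Rightarrow> 's \<Rightarrow>\<^sub>L 's" where
  "opow X 0 = id_blinfun"
| "opow X (Suc n) = X o\<^sub>L opow X n"

lemma comp_id [simp]: "id_blinfun o\<^sub>L f = f" "f o\<^sub>L id_blinfun = f"
  by (auto intro: blinfun_eqI)

lemma opow_commute: "opow X n o\<^sub>L X = X o\<^sub>L opow X n"
  by (induction n) (auto simp: comp_assoc)

section \<open>Polynomials in an operator\<close>

definition poly_op :: "('s::euclidean_space \<Rightarrow>\<^sub>L 's) \<Rightarrow> real poly \<Rightarrow> 's \<Rightarrow>\<^sub>L 's" where
  "poly_op X p = fold_coeffs (\<lambda>a f. a *\<^sub>R id_blinfun + (X o\<^sub>L f)) p 0"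

lemma poly_op_0 [simp]: "poly_op X 0 = 0"
  by (simp add: poly_op_def)

lemma poly_op_pCons [simp]: "poly_op X (pCons a p) = a *\<^sub>R id_blinfun + (X o\<^sub>L poly_op X p)"
  by (cases "p = 0 \<and> a = 0") (auto simp: poly_op_def fold_coeffs_pCons_not_0_0_eq
      fold_coeffs_pCons_coeff_not_0_eq)

lemma poly_op_add: "poly_op X (p + q) = poly_op X p + poly_op X q"
proof (induction p arbitrary: q)
  case (pCons a p)
  show ?case
  proof (cases q)
    case (pCons b r)
    then show ?thesis using pCons.IH[of r] by (simp add: comp_simps scaleR_left_distrib)
  qed
qed simp

lemma poly_op_smult: "poly_op X (smult c p) = c *\<^sub>R poly_op X p"
  by (induction p) (auto simp: comp_simps scaleR_add_right)

lemma poly_op_diff: "poly_op X (p - q) = poly_op X p - poly_op X q"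
  using poly_op_add[of X "p - q" q] by simp

lemma poly_op_mult: "poly_op X (p * q) = poly_op X p o\<^sub>L poly_op X q"
  by (induction p) (auto simp: poly_op_add poly_op_smult comp_simps comp_assoc)

lemma poly_op_monom: "poly_op X (monom c n) = c *\<^sub>R opow X n"
  by (induction n) (auto simp: monom_0 monom_Suc comp_simps)

lemma poly_op_sum: "poly_op X (sum f A) = (\<Sum>i\<in>A. poly_op X (f i))"
  by (induction A rule: infinite_finite_induct) (auto simp: poly_op_add)

text \<open>Among the first \<open>DIM('s) + 1\<close> iterates of \<open>v\<close> there is a
  linear relation, which is read as a polynomial. A repeated iterate is treated separately because
  dependence is a property of the set of iterates, in which repetitions collapse.\<close>

lemma vector_annihilated: "\<exists>p. p \<noteq> 0 \<and> poly_op X p (v::'s::euclidean_space) = 0"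
proof (cases "inj_on (\<lambda>i. opow X i v) {..DIM('s)}")
  case False
  then obtain i j where ij: "i \<noteq> j" "opow X i v = opow X j v"
    by (auto simp: inj_on_def)
  let ?p = "monom 1 i - monom 1 j :: real poly"
  have "coeff ?p i \<noteq> 0" using ij(1) by simp
  then have "?p \<noteq> 0" by (metis coeff_0)
  moreover have "poly_op X ?p v = 0"
    using ij(2) by (simp add: poly_op_diff poly_op_monom blinfun.bilinear_simps)
  ultimately show ?thesis by blast
next
  case True
  let ?f = "\<lambda>i. blinfun_apply (opow X i) v" and ?I = "{..DIM('s)}"
  have "card (?f ` ?I) > DIM('s)" using card_image[OF True] by simp
  then have "dependent (?f ` ?I)" by (intro dependent_biggerset) auto
  then obtain u where u: "\<exists>w\<in>?f ` ?I. u w \<noteq> 0" "(\<Sum>w\<in>?f ` ?I. u w *\<^sub>R w) = 0"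
    by (auto simp: dependent_finite)
  define p where "p = (\<Sum>i\<in>?I. monom (u (?f i)) i)"
  obtain k where k: "k \<in> ?I" "u (?f k) \<noteq> 0" using u(1) by blast
  have "coeff p k = u (?f k)"
    using k(1) by (simp add: p_def coeff_sum)
  then have "p \<noteq> 0" using k(2) by auto
  moreover have "poly_op X p v = (\<Sum>i\<in>?I. u (?f i) *\<^sub>R ?f i)"
    by (simp add: p_def poly_op_sum poly_op_monom blinfun.sum_left blinfun.scaleR_left)
  then have "poly_op X p v = 0" using u(2) by (simp add: sum.reindex[OF True])
  ultimately show ?thesis by blast
qed

text \<open>Polynomials in \<open>X\<close> commute, so a product of annihilators of the basis
  vectors kills all of them at once.\<close>

lemma operator_annihilated: "\<exists>p. p \<noteq> 0 \<and> poly_op X p = 0"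
proof -
  have "\<exists>p. p \<noteq> 0 \<and> (\<forall>v\<in>F. poly_op X p v = 0)" if "finite F" for F
    using that
  proof induction
    case (insert v F)
    then obtain p where p: "p \<noteq> 0" "\<forall>v\<in>F. poly_op X p v = 0" by blast
    obtain q where q: "q \<noteq> 0" "poly_op X q v = 0" using vector_annihilated by blast
    have "poly_op X (p * q) v = 0" using q(2) by (simp add: poly_op_mult)
    moreover have "poly_op X (q * p) w = 0" if "w \<in> F" for w
      using p(2) that by (simp add: poly_op_mult)
    ultimately have "p * q \<noteq> 0 \<and> (\<forall>w\<in>insert v F. poly_op X (p * q) w = 0)"
      using p(1) q(1) by (auto simp: mult.commute)
    then show ?case by blast
  qed (auto intro: exI[of _ 1])
  from this[OF finite_Basis] obtain p where
    p: "p \<noteq> 0" "\<forall>v\<in>Basis. poly_op X p v = 0" by blast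
  from p(2) have "poly_op X p = 0" by (intro blinfun_euclidean_eqI) auto
  with p(1) show ?thesis by blast
qed

text \<open>The form \<open>h\<close> makes range and kernel of \<open>E\<close> orthogonal, so
  \<open>E\<close> is self-adjoint for it and \<open>tr E = tr (E o\<^sub>L E)\<close> is its
  squared norm.\<close>

lemma idempotent_trace_0:
  fixes E :: "'s::euclidean_space \<Rightarrow>\<^sub>L 's"
  assumes E: "E o\<^sub>L E = E" "tr E = 0"
  shows "E = 0"
proof -
  have EE [simp]: "E (E x) = E x" for x using E(1) by (metis blinfun_apply_blinfun_compose)
  define h where "h x y = E x \<bullet> E y + (x - E x) \<bullet> (y - E y)" for x y
  have "bilinear h"
    unfolding bilinear_def h_def
    by (auto intro!: linearI simp: blinfun.bilinear_simps algebra_simps inner_add_left inner_add_right)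
  moreover have "h x x > 0" if "x \<noteq> 0" for x
  proof (cases "E x = 0")
    case False
    then have "E x \<bullet> E x > 0" by simp
    then show ?thesis unfolding h_def by (intro add_pos_nonneg) auto
  qed (use that in \<open>simp add: h_def\<close>)
  ultimately interpret h: inner_prod h
    by unfold_locales (simp add: inner_product_def h_def inner_commute)
  have "h.adj E = E"
    by (rule h.adjI) (simp add: h_def)
  then show ?thesis using h.tr_adj_self_eq_0[of E] E by simp
qed

text \<open>
  If \<open>x^i * q\<close> annihilates \<open>X\<close> and \<open>q\<close> has nonzero constant term, then \<open>1 - x * s\<close> is a multiple of
  \<open>q\<close> for some \<open>s\<close>, and \<open>(x * s)^i\<close> becomes the Fitting idempotent of \<open>X\<close>.  It is a combination
  of positive powers of \<open>X\<close>, so its trace, which is its rank, vanishes.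
\<close>

lemma nilpotent_if_trace_powers_0:
  fixes X :: "'s::euclidean_space \<Rightarrow>\<^sub>L 's"
  assumes "\<And>j. tr (opow X (Suc j)) = 0"
  shows "\<exists>m. opow X m = 0"
proof -
  let ?x = "[:0, 1:] :: real poly"
  obtain p where p: "p \<noteq> 0" "poly_op X p = 0" using operator_annihilated by blast
  obtain q where q: "p = ?x ^ order 0 p * q" "\<not> ?x dvd q"
    using order_decomp[OF p(1), of 0] by auto
  obtain c r where qcr: "q = pCons c r" by (cases q)
  have c: "c \<noteq> 0"
  proof
    assume "c = 0"
    then have "q = ?x * r" by (simp add: qcr)
    then show False using q(2) by (metis dvd_triv_left)
  qed
  \<comment> \<open>The successor ensures that \<open>e\<close> has no constant term even if
    \<open>0\<close> is not a root of \<open>p\<close>.\<close>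
  define i where "i = Suc (order 0 p)"
  \<comment> \<open>Since \<open>q = c + x * r\<close>, this choice makes \<open>1 - x * s\<close>
    equal to \<open>q / c\<close>.\<close>
  define s where "s = smult (- 1 / c) r"
  define e where "e = (?x * s) ^ i"
  have 1: "1 - ?x * s = smult (1 / c) q"
    using c by (simp add: s_def qcr one_pCons)
  have "1 - e = (1 - ?x * s) * (\<Sum>j<i. (?x * s) ^ j)"
    unfolding e_def by (rule one_diff_power_eq)
  moreover have "(u * v) * (smult d q * w) = smult d (u * w) * (v * q)"
    for d and u v w :: "real poly" by (simp add: algebra_simps)
  ultimately have "?x ^ i * (1 - e) = smult (1 / c) (?x * (\<Sum>j<i. (?x * s) ^ j)) * (?x ^ order 0 p * q)"
    unfolding 1 i_def power_Suc by metis
  then have kill: "poly_op X (?x ^ i * (1 - e)) = 0"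
    unfolding q(1)[symmetric] by (simp only: poly_op_mult p(2) blinfun_compose_zero)
  have "e * (1 - e) = s ^ i * (?x ^ i * (1 - e))"
    unfolding e_def by (simp only: power_mult_distrib) (simp add: algebra_simps)
  then have "poly_op X (e * (1 - e)) = 0"
    by (simp only: poly_op_mult[of X "s ^ i"] kill blinfun_compose_zero)
  then have "poly_op X e o\<^sub>L poly_op X e = poly_op X e"
    by (simp add: right_diff_distrib poly_op_diff poly_op_mult)
  moreover have "tr (poly_op X e) = 0"
  proof -
    have *: "tr (opow X (Suc k) o\<^sub>L poly_op X w) = 0" for k w
    proof (induction w arbitrary: k)
      case (pCons a w)
      have "opow X (Suc k) o\<^sub>L (X o\<^sub>L poly_op X w) = opow X (Suc (Suc k)) o\<^sub>L poly_op X w"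
        by (metis comp_assoc opow_commute opow.simps(2))
      then show ?case using pCons.IH[of "Suc k"] assms[of k]
        by (simp add: comp_simps tr_simps del: opow.simps)
    qed (simp add: tr_simps)
    have "e = ?x * (s * (?x * s) ^ order 0 p)"
      by (simp add: e_def i_def mult.assoc)
    then have "poly_op X e = opow X (Suc 0) o\<^sub>L poly_op X (s * (?x * s) ^ order 0 p)"
      by (simp only: poly_op_mult[of X ?x]) (simp add: comp_simps)
    then show ?thesis using * by presburger
  qed
  ultimately have "poly_op X e = 0" by (rule idempotent_trace_0)
  \<comment> \<open>Once the idempotent vanishes, the relation \<open>kill\<close> reduces to
    \<open>X^i = 0\<close>.\<close>
  then have "poly_op X (?x ^ i) = 0"
    using kill by (simp add: right_diff_distrib poly_op_diff poly_op_mult)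
  moreover have "?x ^ i = monom 1 i" by (simp add: monom_altdef)
  ultimately show ?thesis by (metis poly_op_monom scaleR_one)
qed

section \<open>Lie algebras with abelian nilradical\<close>

text \<open>By cyclicity, tr ([V, X] Z) = tr (V [X, Z]).\<close>

lemma tr_commutator_0:
  assumes "X o\<^sub>L Z = Z o\<^sub>L X"
  shows "tr (((V o\<^sub>L X) - (X o\<^sub>L V)) o\<^sub>L Z) = 0"
proof -
  have "tr (X o\<^sub>L (V o\<^sub>L Z)) = tr (V o\<^sub>L (X o\<^sub>L Z))"
    by (subst tr_commute) (simp add: comp_assoc assms)
  then show ?thesis by (simp add: comp_simps tr_simps comp_assoc)
qed

text \<open>Jacobson's lemma: powers of \<open>Y\<close> commute with \<open>X\<close>, so
  \<open>tr_commutator_0\<close> makes the traces of all positive powers of \<open>Y\<close>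
  vanish.\<close>

lemma nilpotent_commutator:
  assumes "Y = c *\<^sub>R ((V o\<^sub>L X) - (X o\<^sub>L V))" "X o\<^sub>L Y = Y o\<^sub>L X"
  shows "\<exists>m. opow Y m = 0"
proof (rule nilpotent_if_trace_powers_0)
  fix j
  have "X o\<^sub>L opow Y j = opow Y j o\<^sub>L X"
    by (induction j) (auto simp: assms(2) comp_assoc[symmetric], simp add: assms(2) comp_assoc)
  from tr_commutator_0[OF this, of V] show "tr (opow Y (Suc j)) = 0"
    unfolding opow.simps by (subst (1) assms(1)) (simp only: comp_simps tr_simps scaleR_zero_right)
qed

section \<open>Brackets, ideals and the derived series\<close>

locale lie =
  fixes br :: "'s::euclidean_space \<Rightarrow> 's \<Rightarrow> 's"
  assumes lie_algebra: "lie_algebra br"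
begin

sublocale br: bounded_bilinear br
  using lie_algebra by (auto simp: lie_algebra_def bilinear_conv_bounded_bilinear)

lemma br_self [simp]: "br x x = 0"
  using lie_algebra by (auto simp: lie_algebra_def)

lemma antisym: "br x y = - br y x"
proof -
  have "br (x + y) (x + y) = br x y + br y x"
    unfolding br.add_left br.add_right by simp
  then show ?thesis by (simp add: eq_neg_iff_add_eq_0)
qed

lemma jacobi: "br x (br y z) = br (br x y) z + br y (br x z)"
proof -
  have "br x (br y z) + br y (br z x) + br z (br x y) = 0"
    using lie_algebra by (auto simp: lie_algebra_def)
  moreover have "br y (br z x) = - br y (br x z)" "br z (br x y) = - br (br x y) z"
    using antisym[of z x] antisym[of z "br x y"] by (simp_all add: br.minus_right)
  ultimately show ?thesis by (simp add: algebra_simps eq_neg_iff_add_eq_0)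
qed

lemma br_span:
  assumes "subspace W" "x \<in> span A" "y \<in> span B"
    and "\<And>a b. a \<in> A \<Longrightarrow> b \<in> B \<Longrightarrow> br a b \<in> W"
  shows "br x y \<in> W"
proof -
  have W: "u \<in> W \<Longrightarrow> v \<in> W \<Longrightarrow> c *\<^sub>R u + v \<in> W" "0 \<in> W" for u v c
    using assms(1) by (simp_all add: subspace_add subspace_scale subspace_0)
  have *: "br a y \<in> W" if "a \<in> A" for a
    using assms(3)
    by (induction rule: span_induct_alt)
      (use that assms(4) in \<open>auto simp: br.zero_right br.add_right br.scaleR_right intro!: W\<close>)
  show ?thesis
    using assms(2)
    by (induction rule: span_induct_alt)
      (use * in \<open>auto simp: br.zero_left br.add_left br.scaleR_left intro!: W\<close>)
qed

lemma br_in_bracket_span: "x \<in> A \<Longrightarrow> y \<in> B \<Longrightarrow> br x y \<in> bracket_span br A B"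
  unfolding bracket_span_def by (intro span_base) blast

lemma lie_ideal_bracket_span:
  assumes "lie_ideal br I" "lie_ideal br J"
  shows "lie_ideal br (bracket_span br I J)"
  unfolding lie_ideal_def
proof (intro conjI allI ballI)
  fix x y assume "y \<in> bracket_span br I J"
  then show "br x y \<in> bracket_span br I J"
  proof (intro br_span[of _ x "{x}" y "{br x y | x y. x \<in> I \<and> y \<in> J}"])
    fix a b assume "a \<in> {x}" "b \<in> {br x y | x y. x \<in> I \<and> y \<in> J}"
    then obtain u v where uv: "b = br u v" "u \<in> I" "v \<in> J" by blast
    have "br a b = br (br a u) v + br u (br a v)" unfolding uv(1) by (rule jacobi)
    moreover have "br a u \<in> I" "br a v \<in> J" using assms uv by (auto simp: lie_ideal_def)
    ultimately show "br a b \<in> bracket_span br I J"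
      using uv by (simp add: bracket_span_def span_add br_in_bracket_span[unfolded bracket_span_def])
  qed (auto simp: bracket_span_def intro: span_base)
qed (simp add: bracket_span_def)

lemma lie_ideal_derived_series: "lie_ideal br (derived_series br k)"
proof (induction k)
  case 0
  show ?case by (simp add: lie_ideal_def)
next
  case (Suc k)
  then show ?case by (simp add: lie_ideal_bracket_span)
qed

end

text \<open>\<open>p\<close> is a projection onto \<open>n\<close> whose kernel serves as \<aa>. No
  metric enters, so one \<open>p\<close> can be shared by all metrics with the same
  complement.\<close>

locale split_lie = lie br for br :: "'s::euclidean_space \<Rightarrow> 's \<Rightarrow> 's" +
  fixes n :: "'s set" and p :: "'s \<Rightarrow>\<^sub>L 's"
  assumes solvable: "solvable_lie br" and nilradical: "is_nilradical br n"
    and abelian: "abelian_on br n"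
    and p_in [simp]: "\<And>x. p x \<in> n" and p_id [simp]: "\<And>x. x \<in> n \<Longrightarrow> p x = x"
begin

lemma subspace_n: "subspace n" and br_n [simp]: "y \<in> n \<Longrightarrow> br x y \<in> n"
  using nilradical by (auto simp: is_nilradical_def nilpotent_ideal_def lie_ideal_def)

lemma br_n' [simp]: "x \<in> n \<Longrightarrow> br x y \<in> n"
  using antisym[of x y] br_n[of x y] subspace_neg[OF subspace_n] by simp

lemma br_nn [simp]: "x \<in> n \<Longrightarrow> y \<in> n \<Longrightarrow> br x y = 0"
  using abelian by (auto simp: abelian_on_def)

lemma foldr_br_n: "v \<in> n \<Longrightarrow> foldr br ws v \<in> n"
  by (induction ws) auto

lemma funpow_br_n: "v \<in> n \<Longrightarrow> (br x ^^ m) v \<in> n"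
  by (induction m) auto

lemma funpow_br_0: "(br x ^^ m) 0 = 0"
  by (induction m) (auto simp: br.zero_right)

text \<open>Brackets within \<open>K\<close> lie in the abelian ideal \<open>n\<close>, so the
  operators \<open>br x\<close> with \<open>x \<in> K\<close> commute on \<open>n\<close>. A long
  word in finitely many commuting nilpotent letters repeats some letter often enough to
  vanish.\<close>

lemma words_vanish:
  assumes "finite F" and com: "\<And>x y. x \<in> K \<Longrightarrow> y \<in> K \<Longrightarrow> br x y \<in> n"
    and nil: "\<And>x. x \<in> K \<Longrightarrow> \<exists>m. \<forall>v\<in>n. (br x ^^ m) v = 0" and "F \<subseteq> K"
  shows "\<exists>M. \<forall>ws. set ws \<subseteq> F \<longrightarrow> length ws \<ge> M \<longrightarrow> (\<forall>v\<in>n. foldr br ws v = 0)"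
  using assms(1,4)
proof (induction F)
  case empty
  show ?case by (intro exI[of _ 1]) auto
next
  case (insert x F)
  then obtain M where M: "\<And>ws v. set ws \<subseteq> F \<Longrightarrow> length ws \<ge> M \<Longrightarrow> v \<in> n \<Longrightarrow> foldr br ws v = 0"
    by auto
  obtain m where m: "\<And>v. v \<in> n \<Longrightarrow> (br x ^^ m) v = 0" using nil insert.prems by blast
  have swap: "br a ((br x ^^ c) v) = (br x ^^ c) (br a v)" if "a \<in> K" "v \<in> n" for a c v
  proof (induction c)
    case (Suc c)
    have "br a (br x ((br x ^^ c) v)) = br x (br a ((br x ^^ c) v))"
      using jacobi[of a x "(br x ^^ c) v"] com[of a x] that insert.prems funpow_br_n[OF that(2)]
      by simp
    then show ?case by (simp add: Suc)
  qed simp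
  let ?r = "filter (\<lambda>y. y \<noteq> x)" and ?c = "\<lambda>ws. length (filter (\<lambda>y. y = x) ws)"
  \<comment> \<open>All occurrences of \<open>x\<close> are moved to the front; then either
    \<open>x\<close> occurs \<open>m\<close> times or at least \<open>M\<close> letters from
    \<open>F\<close> remain.\<close>
  have sort: "foldr br ws v = (br x ^^ ?c ws) (foldr br (?r ws) v)"
    if "set ws \<subseteq> K" "v \<in> n" for ws v
    using that(1) by (induction ws) (auto simp: swap foldr_br_n that(2))
  have "foldr br ws v = 0" if ws: "set ws \<subseteq> insert x F" "length ws \<ge> M + m" "v \<in> n" for ws v
  proof -
    have s: "foldr br ws v = (br x ^^ ?c ws) (foldr br (?r ws) v)"
      using ws insert.prems by (intro sort) auto
    show ?thesis
    proof (cases "?c ws \<ge> m")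
      case True
      then have "(br x ^^ ?c ws) (foldr br (?r ws) v) = (br x ^^ m) ((br x ^^ (?c ws - m)) (foldr br (?r ws) v))"
        by (simp flip: funpow_add comp_apply[of "br x ^^ m"])
      then show ?thesis unfolding s by (simp add: m funpow_br_n foldr_br_n ws(3))
    next
      case False
      then have "length (?r ws) \<ge> M" using sum_length_filter_compl[of "\<lambda>y. y = x" ws] ws(2) by linarith
      then have "foldr br (?r ws) v = 0" using ws by (intro M) auto
      then show ?thesis unfolding s by (simp add: funpow_br_0)
    qed
  qed
  then show ?case by blast
qed

text \<open>An Engel-type criterion: the span of \<open>K\<close> and \<open>n\<close> is shown to
  be a nilpotent ideal, hence contained in the maximal one.\<close>

lemma subset_nilradical:
  assumes ideal: "\<And>v x. x \<in> K \<Longrightarrow> br v x \<in> span (K \<union> n)"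
    and com: "\<And>x y. x \<in> K \<Longrightarrow> y \<in> K \<Longrightarrow> br x y \<in> n"
    and nil: "\<And>x. x \<in> K \<Longrightarrow> \<exists>m. \<forall>v\<in>n. (br x ^^ m) v = 0"
  shows "K \<subseteq> n"
proof -
  define J where "J = span (K \<union> n)"
  \<comment> \<open>\<open>K\<close> may be infinite, while \<open>words_vanish\<close> needs
    finitely many letters.\<close>
  obtain F where F: "F \<subseteq> K" "independent F" "K \<subseteq> span F"
    using maximal_independent_subset[of K] by blast
  have finF: "finite F" using F(2) by (rule independent_imp_finite)
  have "K \<union> n \<subseteq> span (F \<union> n)"
    using F(3) span_mono[of F "F \<union> n"] span_superset[of "F \<union> n"] by blast
  then have J: "J = span (F \<union> n)"
    unfolding J_def using F(1) by (metis Un_mono span_mono span_minimal span_superset subset_antisym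
        subset_refl subspace_span)
  obtain M where M: "\<And>ws v. set ws \<subseteq> F \<Longrightarrow> length ws \<ge> M \<Longrightarrow> v \<in> n \<Longrightarrow> foldr br ws v = 0"
    using words_vanish[OF finF com nil F(1)] by blast
  have "lie_ideal br J"
    unfolding lie_ideal_def
  proof (intro conjI allI ballI)
    fix x y assume "y \<in> J"
    then show "br x y \<in> J"
      unfolding J_def using ideal
      by (intro br_span[of _ x "{x}" y "K \<union> n"]) (auto intro: span_base)
  qed (simp add: J_def)
  moreover have "lower_central_series br J (Suc M) = {0}"
  proof -
    define W where "W k = {foldr br ws v | ws v. set ws \<subseteq> F \<and> length ws = k \<and> v \<in> n}" for k
    \<comment> \<open>The first bracket only brings \<open>J\<close> into \<open>n\<close>, hence
      the shift of the index. Each further one prepends a letter from \<open>F\<close>, since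
      elements of \<open>n\<close> act on \<open>n\<close> by zero.\<close>
    have "lower_central_series br J (Suc k) \<subseteq> span (W k)" for k
    proof (induction k)
      case 0
      have W0: "span (W 0) = n" using span_eq_iff[of n] subspace_n by (simp add: W_def)
      have "br x y \<in> n" if "x \<in> J" "y \<in> J" for x y
        using that unfolding J_def by (rule br_span[OF subspace_n]) (use com subspace_0[OF subspace_n] in auto)
      then show ?case
        unfolding W0 lower_central_series.simps bracket_span_def
        by (intro span_minimal subspace_n) auto
    next
      case (Suc k)
      have "br x y \<in> span (W (Suc k))" if "x \<in> J" "y \<in> span (W k)" for x y
        using that unfolding J
      proof (rule br_span[OF subspace_span])
        fix a b assume a: "a \<in> F \<union> n" and "b \<in> W k"
        then obtain ws v where b: "b = foldr br ws v" "set ws \<subseteq> F" "length ws = k" "v \<in> n"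
          by (auto simp: W_def)
        show "br a b \<in> span (W (Suc k))"
        proof (cases "a \<in> F")
          case True
          then have "br a b \<in> W (Suc k)"
            unfolding W_def using b by (intro CollectI exI[of _ "a # ws"] exI[of _ v]) auto
          then show ?thesis by (rule span_base)
        next
          case False
          then show ?thesis using a b by (simp add: foldr_br_n span_zero)
        qed
      qed
      then show ?case
        unfolding lower_central_series.simps(2)[of br J "Suc k"] bracket_span_def
        using Suc by (intro span_minimal subspace_span) blast
    qed
    moreover have "span (W M) \<subseteq> {0}"
      by (rule span_minimal) (auto simp: W_def M)
    moreover have "0 \<in> lower_central_series br J (Suc M)"
      by (simp add: bracket_span_def span_zero)
    ultimately show ?thesis by blast
  qed
  ultimately have "J \<subseteq> n"
    using nilradical unfolding is_nilradical_def nilpotent_ideal_def by blast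
  then show ?thesis using span_superset[of "K \<union> n"] by (auto simp: J_def)
qed

text \<open>Composing with \<open>p\<close> allows traces and adjoints of the action on \<open>n\<close> to be taken on the whole space.\<close>

definition T :: "'s \<Rightarrow> 's \<Rightarrow>\<^sub>L 's" where
  "T x = Blinfun (\<lambda>v. br x (p v))"

lemma T_apply [simp]: "T x v = br x (p v)"
  unfolding T_def
  by (subst Blinfun_linear)
    (auto intro!: linearI simp: blinfun.bilinear_simps br.add_right br.scaleR_right)

lemma linear_T: "linear T"
  by (intro linearI blinfun_eqI)
    (auto simp: blinfun.bilinear_simps br.add_left br.scaleR_left)

lemmas T_simps = linear_add[OF linear_T] linear_diff[OF linear_T] linear_cmul[OF linear_T]
  linear_sum[OF linear_T] linear_neg[OF linear_T] linear_0[OF linear_T]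

lemma T_n: "x \<in> n \<Longrightarrow> T x = 0"
  by (intro blinfun_eqI) simp

lemma T_br: "T (br x y) = (T x o\<^sub>L T y) - (T y o\<^sub>L T x)"
  by (intro blinfun_eqI) (simp add: blinfun.bilinear_simps jacobi[of x y])

lemma opow_T: "v \<in> n \<Longrightarrow> opow (T x) m v = (br x ^^ m) v"
  by (induction m) (auto simp: funpow_br_n)

lemma nilpotent_T: "\<exists>m. opow (T x) m = 0 \<Longrightarrow> \<exists>m. \<forall>v\<in>n. (br x ^^ m) v = 0"
  by (metis opow_T zero_blinfun.rep_eq)

text \<open>Let m be the ideal on the left of the conclusion. As [m, m] lies in \<open>n\<close>,
  the operators \<open>T x\<close> with x in m commute; \<open>subset_nilradical\<close> is applied
  first to [s, m] and then to m itself.\<close>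

lemma derived_series_step:
  assumes "derived_series br (Suc (Suc k)) \<subseteq> n"
  shows "derived_series br (Suc k) \<subseteq> n"
proof -
  let ?m = "derived_series br (Suc k)"
  have mm: "br x y \<in> n" if "x \<in> ?m" "y \<in> ?m" for x y
    using br_in_bracket_span[OF that] assms by auto
  have ideal: "br v x \<in> ?m" if "x \<in> ?m" for v x
    using lie_ideal_derived_series[of "Suc k"] that unfolding lie_ideal_def by blast
  have TT: "T x o\<^sub>L T y = T y o\<^sub>L T x" if "br x y \<in> n" for x y
    using T_br[of x y] T_n[OF that] by simp
  \<comment> \<open>For \<open>y = br v x\<close>, the operator \<open>T y\<close> is the commutator
    of \<open>T v\<close> and \<open>T x\<close> and commutes with \<open>T x\<close>, so Jacobson's
    lemma gives nilpotency.\<close>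
  have "{br v x | v x. x \<in> ?m} \<subseteq> n"
  proof (rule subset_nilradical)
    fix v y assume "y \<in> {br v x | v x. x \<in> ?m}"
    then obtain w x where y: "y = br w x" "x \<in> ?m" by blast
    have "br v y = br (br v w) x + br w (br v x)" unfolding y(1) by (rule jacobi)
    moreover have "br (br v w) x \<in> {br v x | v x. x \<in> ?m}" "br w (br v x) \<in> {br v x | v x. x \<in> ?m}"
      using y(2) ideal[of x v] by blast+
    ultimately show "br v y \<in> span ({br v x | v x. x \<in> ?m} \<union> n)"
      by (simp add: span_add span_base del: derived_series.simps)
  next
    fix x y assume "x \<in> {br v x | v x. x \<in> ?m}" "y \<in> {br v x | v x. x \<in> ?m}"
    then show "br x y \<in> n" using ideal mm by blast
  next
    fix y assume "y \<in> {br v x | v x. x \<in> ?m}"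
    then obtain v x where y: "y = br v x" "x \<in> ?m" by blast
    have "T y = 1 *\<^sub>R ((T v o\<^sub>L T x) - (T x o\<^sub>L T v))" by (simp add: y(1) T_br)
    moreover have "T x o\<^sub>L T y = T y o\<^sub>L T x"
      unfolding y(1) by (intro TT mm ideal y(2))
    ultimately show "\<exists>m. \<forall>v\<in>n. (br y ^^ m) v = 0"
      by (intro nilpotent_T nilpotent_commutator)
  qed
  then have vx: "br v x \<in> n" if "x \<in> ?m" for v x using that by blast
  show ?thesis
  proof (rule subset_nilradical)
    fix x assume x: "x \<in> ?m"
    have "\<exists>m. opow (T x) m = 0"
    proof (rule nilpotent_if_trace_powers_0)
      fix j
      \<comment> \<open>Now that [s, m] lies in \<open>n\<close>, \<open>T x\<close> commutes with
        every \<open>T u\<close>, not only with those for \<open>u\<close> in m.\<close>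
      have com: "T u o\<^sub>L opow (T x) j = opow (T x) j o\<^sub>L T u" for u
        by (induction j) (auto simp: comp_assoc TT[OF vx[OF x], of u]
            simp flip: comp_assoc[of "T u"] comp_assoc[of _ "T u"] comp_assoc[of _ "T x"])
      \<comment> \<open>The form vanishes on brackets and therefore on m, which they span;
        evaluating it at \<open>x\<close> itself gives the trace of the next power.\<close>
      have "linear (\<lambda>y. tr (T y o\<^sub>L opow (T x) j))"
        by (rule linearI) (simp_all add: T_simps comp_simps tr_simps)
      then have sub: "subspace {y. tr (T y o\<^sub>L opow (T x) j) = 0}"
        by (rule linear_subspace_kernel)
      have "tr (T (br u w) o\<^sub>L opow (T x) j) = 0" for u w
        unfolding T_br by (intro tr_commutator_0 com)
      then have "?m \<subseteq> {y. tr (T y o\<^sub>L opow (T x) j) = 0}"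
        unfolding derived_series.simps bracket_span_def by (intro span_minimal sub) auto
      then show "tr (opow (T x) (Suc j)) = 0" using x by auto
    qed
    then show "\<exists>m. \<forall>v\<in>n. (br x ^^ m) v = 0" by (rule nilpotent_T)
  qed (use mm vx in \<open>auto intro: span_base\<close>)
qed

text \<open>Starting from a vanishing term, \<open>derived_series_step\<close> carries containment
  in \<open>n\<close> back to the derived algebra. This is what makes all \<open>T x\<close>
  commute.\<close>

lemma br_in_n [simp]: "br x y \<in> n"
proof -
  obtain k where k: "derived_series br k = {0}" using solvable by (auto simp: solvable_lie_def)
  have "{br x y | x y. x \<in> {0} \<and> y \<in> {0}} = {0}" by (auto simp: br.zero_left)
  \<comment> \<open>One more trivial term is added so that the index is a successor even when
    \<open>k = 0\<close>.\<close>
  then have "derived_series br (Suc k) = {0}" by (simp add: k bracket_span_def)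
  then have "derived_series br (Suc k) \<subseteq> n" using subspace_0[OF subspace_n] by simp
  then have "derived_series br (Suc 0) \<subseteq> n"
  proof (induction k)
    case (Suc k)
    then show ?case using derived_series_step by blast
  qed
  then show ?thesis using br_in_bracket_span[of x UNIV y UNIV] by auto
qed

lemma T_commute: "T x o\<^sub>L T y = T y o\<^sub>L T x"
  using T_br[of x y] by (simp add: T_n)

end

section \<open>The Ricci tensor of a metric Lie algebra\<close>

locale metric_lie = lie br + inner_prod g
  for br :: "'s::euclidean_space \<Rightarrow> 's \<Rightarrow> 's" and g :: "'s \<Rightarrow> 's \<Rightarrow> real"
begin

definition ad :: "'s \<Rightarrow> 's \<Rightarrow>\<^sub>L 's" where
  "ad x = Blinfun (br x)"

lemma ad_apply [simp]: "ad x v = br x v"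
  unfolding ad_def by (subst Blinfun_linear) (auto intro!: linearI simp: br.add_right br.scaleR_right)

lemma linear_ad: "linear ad"
  by (intro linearI blinfun_eqI) (auto simp: blinfun.bilinear_simps br.add_left br.scaleR_left)

lemmas ad_simps = linear_add[OF linear_ad] linear_diff[OF linear_ad] linear_cmul[OF linear_ad]
  linear_sum[OF linear_ad] linear_neg[OF linear_ad] linear_0[OF linear_ad]

lemma ad_br: "ad (br x y) = (ad x o\<^sub>L ad y) - (ad y o\<^sub>L ad x)"
  by (intro blinfun_eqI) (simp add: blinfun.bilinear_simps jacobi[of x y])

text \<open>The part of the connection that is skew in \<open>x\<close>:
  \<open>g (J y x) z = - g y (br x z)\<close>.\<close>

definition J :: "'s \<Rightarrow> 's \<Rightarrow>\<^sub>L 's" where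
  "J y = Blinfun (\<lambda>x. - adj (ad x) y)"

lemma J_apply [simp]: "J y x = - adj (ad x) y"
  unfolding J_def
  by (subst Blinfun_linear) (auto intro!: linearI simp: ad_simps adj_simps blinfun.bilinear_simps)

lemma linear_J: "linear J"
  by (intro linearI blinfun_eqI) (auto simp: blinfun.bilinear_simps)

lemma adj_J: "adj (J y) = - J y"
proof (rule adjI)
  fix x w
  show "g ((- J y) x) w = g x (J y w)"
    using antisym[of w x] commute[of _ y]
    by (simp add: blinfun.minus_left g.minus_right adj adj' g.minus_left)
qed

text \<open>\<open>N y\<close> sends \<open>x\<close> to the covariant derivative of
  \<open>y\<close> along \<open>x\<close>, split into its skew part and its symmetric part. With
  \<open>y\<close> as the parameter, the Ricci tensor becomes a trace of products of such
  operators.\<close>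

definition N :: "'s \<Rightarrow> 's \<Rightarrow>\<^sub>L 's" where
  "N y = (1/2) *\<^sub>R (J y - (ad y + adj (ad y)))"

lemma levi_civita: "levi_civita br g x y = N y x"
  unfolding levi_civita_def
proof (rule the_equality)
  have *: "2 * g (N y x) z = g (br x y) z - g (br y z) x + g (br z x) y" for z
    using antisym[of y x] antisym[of z x] commute[of _ x] commute[of _ y]
    by (simp add: N_def blinfun.bilinear_simps g.scaleR_left g.diff_left g.add_left g.minus_left
        adj g.minus_right)
  then show "\<forall>z. 2 * g (N y x) z = g (br x y) z - g (br y z) x + g (br z x) y" by blast
  fix u assume "\<forall>z. 2 * g u z = g (br x y) z - g (br y z) x + g (br z x) y"
  with * have "2 * g u z = 2 * g (N y x) z" for z by metis
  then show "u = N y x" by (intro eqI) simp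
qed

lemma linear_N: "linear N"
  by (rule linearI) (auto simp: N_def linear_add[OF linear_J] linear_cmul[OF linear_J] ad_simps
      adj_simps algebra_simps)

lemma N_torsion: "N y x = N x y + br x y"
  using antisym[of x y] by (simp add: N_def blinfun.bilinear_simps algebra_simps flip: scaleR_add_left)

lemma tr_sym_skew: "adj S = S \<Longrightarrow> adj K = - K \<Longrightarrow> tr (S o\<^sub>L K) = 0"
  using tr_adj[of "S o\<^sub>L K"] tr_commute[of S K] by (simp add: adj_comp comp_simps tr_simps)

definition \<tau> :: "'s \<Rightarrow> real" where "\<tau> x = tr (ad x)"

lemma linear_\<tau>: "linear \<tau>"
  by (rule linearI) (auto simp: \<tau>_def ad_simps tr_simps)

lemma \<tau>_br: "\<tau> (br x y) = 0"
  by (simp add: \<tau>_def ad_br tr_simps tr_commute)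

lemma tr_N: "tr (N x) = - \<tau> x"
proof -
  have "tr (J x) = 0" using tr_adj[of "J x"] by (simp add: adj_J tr_simps)
  then show ?thesis by (simp add: N_def \<tau>_def tr_simps tr_adj)
qed

text \<open>The traces of \<open>\<nabla>\<^sub>y \<circ> N z\<close> that occur in the second and third term of the curvature cancel.\<close>

lemma ricci_tensor_N: "ricci_tensor br g y z = - \<tau> (N z y) - tr (N z o\<^sub>L N y)"
proof -
  have "curvature br g x y z = (N (N z y) - ((N y + ad y) o\<^sub>L N z) + (N z o\<^sub>L ad y)) x" for x
    using N_torsion[of "N z x" y] antisym[of y x]
    by (simp add: curvature_def levi_civita blinfun.bilinear_simps)
  then have "ricci_tensor br g y z = tr (N (N z y) - ((N y + ad y) o\<^sub>L N z) + (N z o\<^sub>L ad y))"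
    by (simp add: ricci_tensor_def tr_def)
  also have "\<dots> = - \<tau> (N z y) - tr (N z o\<^sub>L N y)"
    by (simp add: tr_simps tr_N comp_simps tr_commute[of "N y"] tr_commute[of "ad y"])
  finally show ?thesis .
qed

text \<open>The mean curvature vector, which represents the trace form \<tau> with respect to
  \<open>g\<close>.\<close>

definition H :: 's where
  "H = (\<Sum>b\<in>(SOME B. onb UNIV B). \<tau> b *\<^sub>R b)"

lemma g_H: "g H x = \<tau> x"
proof -
  define B where "B = (SOME B. onb UNIV B)"
  have B: "onb UNIV B" unfolding B_def using someI_ex[OF exists_onb[of UNIV]] by simp
  have "\<tau> x = \<tau> (\<Sum>b\<in>B. g x b *\<^sub>R b)" by (simp add: onb_expand[OF B])
  also have "\<dots> = g H x"
    by (simp add: linear_sum[OF linear_\<tau>] linear_cmul[OF linear_\<tau>] H_def B_def[symmetric]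
        g.sum_left g.scaleR_left commute[of x] mult.commute)
  finally show ?thesis by simp
qed

lemma \<tau>_N: "\<tau> (N z y) = (1/2) * (g (br H z) y + g (br H y) z)"
proof -
  have "\<tau> (N z y) = g H (N z y)" by (simp add: g_H)
  also have "\<dots> = (1/2) * (\<tau> (br y z) - g (br z H) y - g (br y H) z)"
    using antisym[of z y]
    by (simp add: N_def blinfun.bilinear_simps g.scaleR_right g.diff_right g.add_right
        g.minus_right adj' g_H[symmetric] algebra_simps)
  finally show ?thesis
    using antisym[of z H] antisym[of y H] by (simp add: \<tau>_br g.minus_left)
qed

lemma tr_J_J:
  assumes "onb UNIV B"
  shows "tr (J z o\<^sub>L J y) = - (\<Sum>b\<in>B. \<Sum>c\<in>B. g (br b c) y * g (br b c) z)"
proof -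
  have "g (J z (J y b)) b = - (\<Sum>c\<in>B. g (br b c) y * g (br b c) z)" for b
  proof -
    have "g (J z (J y b)) b = g (J y b) (adj (J z) b)" by (simp only: adj')
    also have "\<dots> = - g (J y b) (J z b)" by (simp add: adj_J blinfun.minus_left g.minus_right)
    also have "\<dots> = - g (adj (ad b) y) (adj (ad b) z)" by (simp add: g.minus_left g.minus_right)
    also have "\<dots> = - (\<Sum>c\<in>B. g (adj (ad b) y) c * g c (adj (ad b) z))"
      by (subst onb_parseval[OF assms UNIV_I, symmetric]) (rule refl)
    finally show ?thesis by (simp add: adj adj' commute[of y])
  qed
  then show ?thesis by (simp add: tr_onb[OF assms] sum_negf)
qed

text \<open>In the product \<open>N z o\<^sub>L N y\<close> the cross terms pair a symmetric with a
  skew operator and have trace zero, so only the two pure products survive.\<close>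

lemma ricci_tensor_formula:
  assumes B: "onb UNIV B"
  shows "ricci_tensor br g y z = - (1/2) * (g (br H z) y + g (br H y) z)
    - (1/2) * tr (ad z o\<^sub>L ad y) - (1/2) * tr (ad z o\<^sub>L adj (ad y))
    + (1/4) * (\<Sum>b\<in>B. \<Sum>c\<in>B. g (br b c) y * g (br b c) z)"
proof -
  let ?S = "\<lambda>x. ad x + adj (ad x)"
  have 1: "tr (J z o\<^sub>L ?S y) = 0" "tr (?S z o\<^sub>L J y) = 0"
    using tr_sym_skew[OF _ adj_J, of "?S y" z] tr_sym_skew[OF _ adj_J, of "?S z" y]
    by (simp_all add: adj_simps add.commute tr_commute[of "J z"])
  have "tr (adj (ad z) o\<^sub>L adj (ad y)) = tr (ad z o\<^sub>L ad y)"
    using tr_adj[of "ad y o\<^sub>L ad z"] by (simp add: adj_comp tr_commute)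
  moreover have "tr (adj (ad z) o\<^sub>L ad y) = tr (ad z o\<^sub>L adj (ad y))"
    using tr_adj[of "ad z o\<^sub>L adj (ad y)"] by (simp add: adj_comp tr_commute)
  ultimately have 2: "tr (?S z o\<^sub>L ?S y) = 2 * tr (ad z o\<^sub>L ad y) + 2 * tr (ad z o\<^sub>L adj (ad y))"
    by (simp add: comp_simps tr_simps)
  have "tr ((c *\<^sub>R (j - s)) o\<^sub>L (c *\<^sub>R (j' - s'))) =
      c * c * (tr (j o\<^sub>L j') - tr (j o\<^sub>L s') - tr (s o\<^sub>L j') + tr (s o\<^sub>L s'))"
    for c and j s j' s' :: "'s \<Rightarrow>\<^sub>L 's" by (simp add: comp_simps tr_simps algebra_simps)
  then have "tr (N z o\<^sub>L N y) = (1/4) *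
      (tr (J z o\<^sub>L J y) - tr (J z o\<^sub>L ?S y) - tr (?S z o\<^sub>L J y) + tr (?S z o\<^sub>L ?S y))"
    unfolding N_def by simp
  then show ?thesis
    unfolding ricci_tensor_N \<tau>_N 1 2 tr_J_J[OF B] by simp
qed

lemma ricci_tensor_commute: "ricci_tensor br g y z = ricci_tensor br g z y"
proof -
  obtain B where B: "onb UNIV B" using exists_onb[of UNIV] by auto
  have "tr (ad y o\<^sub>L adj (ad z)) = tr (ad z o\<^sub>L adj (ad y))"
    using tr_adj[of "ad y o\<^sub>L adj (ad z)"] by (simp add: adj_comp)
  then show ?thesis
    unfolding ricci_tensor_formula[OF B] by (simp add: tr_commute mult.commute add.commute)
qed

lemma linear_ricci_tensor: "linear (ricci_tensor br g y)"
proof -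
  obtain B where B: "onb UNIV B" using exists_onb[of UNIV] by auto
  show ?thesis
    unfolding ricci_tensor_formula[OF B]
    by (rule linearI) (simp_all add: br.add_right br.scaleR_right g.add_left g.add_right
        g.scaleR_left g.scaleR_right ad_simps comp_simps tr_simps sum.distrib sum_distrib_left
        algebra_simps)
qed

definition Ric :: "'s \<Rightarrow>\<^sub>L 's" where "Ric = Blinfun (ricci_operator br g)"

text \<open>Riesz representation in an orthonormal basis provides the vector that the definite
  description asks for.\<close>

lemma g_ricci_operator: "g (ricci_operator br g y) z = ricci_tensor br g y z"
proof -
  obtain B where B: "onb UNIV B" using exists_onb[of UNIV] by auto
  let ?u = "\<Sum>b\<in>B. ricci_tensor br g y b *\<^sub>R b"
  have *: "g ?u z = ricci_tensor br g y z" for z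
  proof -
    have "ricci_tensor br g y z = ricci_tensor br g y (\<Sum>b\<in>B. g z b *\<^sub>R b)"
      by (simp add: onb_expand[OF B])
    also have "\<dots> = g ?u z"
      by (simp add: linear_sum[OF linear_ricci_tensor] linear_cmul[OF linear_ricci_tensor]
          g.sum_left g.scaleR_left commute[of z] mult.commute)
    finally show ?thesis by simp
  qed
  have "ricci_operator br g y = ?u"
    unfolding ricci_operator_def
    by (rule the_equality) (use * in \<open>auto intro: eqI\<close>)
  then show ?thesis by (simp only: *)
qed

lemma Ric_apply: "blinfun_apply Ric = ricci_operator br g"
proof -
  have lin: "linear (\<lambda>y. ricci_tensor br g y z)" for z
    using linear_ricci_tensor[of z] by (simp add: ricci_tensor_commute[of _ z])
  have "linear (ricci_operator br g)"
    by (intro linearI eqI)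
      (simp_all add: g_ricci_operator g.add_left g.scaleR_left linear_add[OF lin] linear_cmul[OF lin])
  then show ?thesis by (simp add: Ric_def Blinfun_linear)
qed

lemma g_Ric: "g (Ric y) z = ricci_tensor br g y z"
  by (simp add: Ric_apply g_ricci_operator)

lemma adj_Ric: "adj Ric = Ric"
  by (rule adjI) (metis commute g_Ric ricci_tensor_commute)

lemma scalar_curvature_Ric: "scalar_curvature br g = tr Ric"
  by (simp add: scalar_curvature_def tr_def Ric_apply)

lemma ricci_norm_sq_Ric: "ricci_norm_sq br g = tr (Ric o\<^sub>L Ric)"
  by (simp add: ricci_norm_sq_def tr_def Ric_apply comp_def blinfun_compose.rep_eq)

lemma ricci_flat_iff: "ricci_flat br g \<longleftrightarrow> Ric = 0"
  by (auto simp: ricci_flat_def fun_eq_iff simp flip: Ric_apply intro: blinfun_eqI)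

lemma ricci_norm_sq_pos: "\<not> ricci_flat br g \<Longrightarrow> ricci_norm_sq br g > 0"
  using tr_adj_self_nonneg[of Ric] tr_adj_self_eq_0[of Ric]
  by (auto simp: ricci_flat_iff ricci_norm_sq_Ric adj_Ric less_le)

end

section \<open>Metrics adapted to a complement of the nilradical\<close>

text \<open>Self-adjointness of \<open>p\<close> encodes that its kernel \<aa> is orthogonal to
  \<open>n\<close>.\<close>

locale split_metric = split_lie br n p + inner_prod g
  for br :: "'s::euclidean_space \<Rightarrow> 's \<Rightarrow> 's" and n :: "'s set" and p :: "'s \<Rightarrow>\<^sub>L 's"
    and g :: "'s \<Rightarrow> 's \<Rightarrow> real" +
  assumes adj_p: "adj p = p"
begin

sublocale metric_lie br g ..

abbreviation (input) \<aa> :: "'s set" where "\<aa> \<equiv> {x. p x = 0}"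

lemma g_p: "g (p x) y = g x (p y)"
  using adj[of p x y] by (simp add: adj_p)

lemma g_an: "p x = 0 \<Longrightarrow> y \<in> n \<Longrightarrow> g x y = 0" "p x = 0 \<Longrightarrow> y \<in> n \<Longrightarrow> g y x = 0"
  using g_p[of x y] g_p[of y x] by (auto simp: g.zero_left g.zero_right)

lemma subspace_a: "subspace \<aa>"
  by (intro linear_subspace_kernel linear_blinfun)

lemma p_T [simp]: "p o\<^sub>L T x = T x" and T_p [simp]: "T x o\<^sub>L p = T x"
  by (intro blinfun_eqI; simp)+

lemma adj_T_p [simp]: "adj (T x) o\<^sub>L p = adj (T x)" and p_adj_T [simp]: "p o\<^sub>L adj (T x) = adj (T x)"
  using arg_cong[OF p_T[of x], of adj] arg_cong[OF T_p[of x], of adj]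
  unfolding adj_comp adj_p by auto

lemma comp_p_a: "f o\<^sub>L p = f \<Longrightarrow> p a = 0 \<Longrightarrow> blinfun_apply f a = 0"
  by (metis blinfun.zero_right blinfun_apply_blinfun_compose)

lemma adj_T_a: "p a = 0 \<Longrightarrow> adj (T x) a = 0"
  by (rule comp_p_a) simp

lemma onb_split:
  assumes A: "onb \<aa> A" and M: "onb n M"
  shows "onb UNIV (A \<union> M)" "A \<inter> M = {}"
proof -
  have a: "p x = 0" if "x \<in> A" for x
    using A that span_base[of x A] by (auto simp: onb_def)
  have m: "x \<in> n" if "x \<in> M" for x
    using M that span_base[of x M] by (auto simp: onb_def)
  show "A \<inter> M = {}"
  proof (rule ccontr)
    assume "A \<inter> M \<noteq> {}"
    then obtain x where x: "x \<in> A" "x \<in> M" by blast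
    then have "x = 0" using a[of x] m[of x] by simp
    moreover have "g x x = 1" using A x by (simp add: onb_def)
    ultimately show False by (simp add: g.zero_left)
  qed
  have "x \<in> span (A \<union> M)" for x
  proof -
    have "p (x - p x) = 0" by (simp add: blinfun.diff_right)
    then have "x - p x \<in> span A" "p x \<in> span M" using A M by (auto simp: onb_def)
    then have "(x - p x) + p x \<in> span (A \<union> M)"
      by (intro span_add) (use span_mono[of A "A \<union> M"] span_mono[of M "A \<union> M"] in auto)
    then show ?thesis by simp
  qed
  moreover have "g x y = 0" "g y x = 0" if "x \<in> A" "y \<in> M" for x y
    using g_an a m that by auto
  ultimately show "onb UNIV (A \<union> M)"
    using A M \<open>A \<inter> M = {}\<close> unfolding onb_def by auto
qed

definition frame :: "'s set \<Rightarrow> bool" where "frame A \<longleftrightarrow> onb \<aa> A"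

lemma exists_frame: "\<exists>A. frame A"
  unfolding frame_def by (rule exists_onb[OF subspace_a])

lemma frame_a: "frame A \<Longrightarrow> a \<in> A \<Longrightarrow> p a = 0"
  using span_base[of a A] by (auto simp: onb_def frame_def)

lemma finite_frame: "frame A \<Longrightarrow> finite A"
  by (simp add: onb_def frame_def)

text \<open>All brackets lie in \<open>n\<close>, so a factor \<open>p\<close> may be inserted on
  the left; cyclicity moves it to the right, where it turns \<open>ad\<close> into
  \<open>T\<close>.\<close>

lemma tr_ad_ad: "tr (ad z o\<^sub>L ad y) = tr (T z o\<^sub>L T y)"
proof -
  have "ad z o\<^sub>L ad y = p o\<^sub>L (ad z o\<^sub>L ad y)" by (intro blinfun_eqI) simp
  then have "tr (ad z o\<^sub>L ad y) = tr (p o\<^sub>L (ad z o\<^sub>L ad y))" by simp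
  also have "\<dots> = tr ((ad z o\<^sub>L ad y) o\<^sub>L p)" by (rule tr_commute)
  also have "(ad z o\<^sub>L ad y) o\<^sub>L p = T z o\<^sub>L T y" by (intro blinfun_eqI) simp
  finally show ?thesis .
qed

lemma \<tau>_T: "\<tau> x = tr (T x)"
proof -
  have "ad x = p o\<^sub>L ad x" by (intro blinfun_eqI) simp
  then have "tr (ad x) = tr (p o\<^sub>L ad x)" by simp
  also have "\<dots> = tr (ad x o\<^sub>L p)" by (rule tr_commute)
  also have "ad x o\<^sub>L p = T x" by (intro blinfun_eqI) simp
  finally show ?thesis by (simp add: \<tau>_def)
qed

lemma p_H [simp]: "p H = 0"
proof -
  have "g (p H) z = 0" for z by (simp add: g_p g_H \<tau>_T T_n tr_simps)
  then show ?thesis by (intro eqI) (simp add: g.zero_left)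
qed

text \<open>The basis sums are split along \<aa> and \<open>n\<close>: the block of two vectors in
  \<open>n\<close> vanishes, and the two mixed blocks agree by antisymmetry.\<close>

lemma ricci_split:
  assumes A: "frame A"
  shows "ricci_tensor br g y z = - (1/2) * (g (br H z) y + g (br H y) z)
    - (1/2) * tr (T z o\<^sub>L T y) - (1/2) * tr (T z o\<^sub>L adj (T y)) - (1/2) * (\<Sum>a\<in>A. g (br z a) (br y a))
    + (1/4) * (\<Sum>a\<in>A. \<Sum>b\<in>A. g (br a b) y * g (br a b) z)
    + (1/2) * (\<Sum>a\<in>A. g (adj (T a) y) (adj (T a) z))"
proof -
  obtain M where M: "onb n M" using exists_onb[OF subspace_n] by blast
  note B = onb_split[OF A[unfolded frame_def] M]
  have fin: "finite A" "finite M" using A M by (auto simp: onb_def frame_def)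
  have m: "x \<in> n" if "x \<in> M" for x
    using M that span_base[of x M] by (auto simp: onb_def)
  have split: "sum f (A \<union> M) = sum f A + sum f M" for f :: "'s \<Rightarrow> real"
    by (rule sum.union_disjoint[OF fin B(2)])
  have tr': "tr (X o\<^sub>L adj Y) = (\<Sum>b\<in>A \<union> M. g (X b) (Y b))" for X Y :: "'s \<Rightarrow>\<^sub>L 's"
    by (subst tr_commute) (simp add: tr_onb[OF B(1)] adj)
  have 1: "tr (ad z o\<^sub>L adj (ad y)) = tr (T z o\<^sub>L adj (T y)) + (\<Sum>a\<in>A. g (br z a) (br y a))"
    unfolding tr' split using frame_a[OF A] m by (simp add: br.zero_right g.zero_left)
  have 2: "(\<Sum>c\<in>M. g (br a c) y * g (br a c) z) = g (adj (T a) y) (adj (T a) z)" for a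
  proof -
    have "g (adj (T a) y) (adj (T a) z) = (\<Sum>c\<in>A \<union> M. g (adj (T a) y) c * g c (adj (T a) z))"
      by (rule onb_parseval[OF B(1)]) simp
    also have "\<dots> = (\<Sum>c\<in>M. g (br a c) y * g (br a c) z)"
      unfolding split adj adj' using frame_a[OF A] m
      by (simp add: br.zero_right g.zero_left commute[of y])
    finally show ?thesis by simp
  qed
  let ?G = "\<lambda>b c. g (br b c) y * g (br b c) z"
  have G: "?G b c = ?G c b" for b c
    using antisym[of b c] by (simp add: g.minus_left)
  have "(\<Sum>b\<in>M. \<Sum>c\<in>A. ?G b c) = (\<Sum>c\<in>A. \<Sum>b\<in>M. ?G c b)"
    by (subst sum.swap) (simp only: G)
  moreover have "(\<Sum>b\<in>M. \<Sum>c\<in>M. ?G b c) = 0"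
    using m by (simp add: g.zero_left)
  ultimately have 3: "(\<Sum>b\<in>A \<union> M. \<Sum>c\<in>A \<union> M. ?G b c)
      = (\<Sum>b\<in>A. \<Sum>c\<in>A. ?G b c) + 2 * (\<Sum>a\<in>A. g (adj (T a) y) (adj (T a) z))"
    unfolding split sum.distrib by (simp add: 2)
  show ?thesis
    unfolding ricci_tensor_formula[OF B(1)] 1 3 tr_ad_ad by (simp add: algebra_simps)
qed

text \<open>The polarised squared norm of the symmetric part of \<open>T\<close>. In this expanded
  form only the second trace depends on the metric, which is what the comparison of two metrics
  exploits.\<close>

definition Q :: "'s \<Rightarrow> 's \<Rightarrow> real" where
  "Q y z = (1/2) * (tr (T y o\<^sub>L T z) + tr (T y o\<^sub>L adj (T z)))"

lemma Q_commute: "Q y z = Q z y"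
  using tr_adj[of "T y o\<^sub>L adj (T z)"] by (simp add: Q_def tr_commute[of "T y" "T z"] adj_comp)

lemma Q_sym: "Q x x = (1/4) * tr ((T x + adj (T x)) o\<^sub>L adj (T x + adj (T x)))"
  using tr_adj[of "T x o\<^sub>L T x"] tr_commute[of "T x" "adj (T x)"]
  by (simp add: Q_def comp_simps tr_simps adj_simps adj_comp)

lemma Q_nonneg: "Q x x \<ge> 0"
  unfolding Q_sym using tr_adj_self_nonneg by simp

lemma bilinear_Q: "bilinear Q"
  unfolding bilinear_def Q_def
  by (auto intro!: linearI simp: T_simps adj_simps comp_simps tr_simps algebra_simps add_divide_distrib)

definition C :: "'s set \<Rightarrow> 's \<Rightarrow>\<^sub>L 's" where
  "C A = (\<Sum>a\<in>A. (T a o\<^sub>L adj (T a)) - (adj (T a) o\<^sub>L T a))"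

lemma adj_C [simp]: "adj (C A) = C A"
  by (simp add: C_def adj_simps adj_comp)

lemma C_p [simp]: "C A o\<^sub>L p = C A" and p_C [simp]: "p o\<^sub>L C A = C A"
  by (simp_all add: C_def comp_simps comp_assoc) (simp add: comp_assoc[symmetric])

lemma C_a: "p x = 0 \<Longrightarrow> C A x = 0"
  by (rule comp_p_a) simp

lemma tr_C: "tr (C A) = 0"
  by (simp add: C_def tr_simps) (simp add: tr_commute)

text \<open>By cyclicity, the self-commutator of \<open>T a\<close> is trace-orthogonal to
  everything commuting with \<open>T a\<close>. It will be applied to \<open>T H\<close> and to the
  soliton derivation.\<close>

lemma tr_comp_C:
  assumes "\<And>a. a \<in> A \<Longrightarrow> X o\<^sub>L T a = T a o\<^sub>L X"
  shows "tr (X o\<^sub>L C A) = 0"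
proof -
  have "tr (X o\<^sub>L (T a o\<^sub>L adj (T a))) = tr (X o\<^sub>L (adj (T a) o\<^sub>L T a))" if "a \<in> A" for a
  proof -
    have "tr (X o\<^sub>L (T a o\<^sub>L adj (T a))) = tr ((T a o\<^sub>L X) o\<^sub>L adj (T a))"
      by (simp add: assms[OF that] flip: comp_assoc)
    also have "\<dots> = tr ((X o\<^sub>L adj (T a)) o\<^sub>L T a)"
      by (subst tr_commute[of "X o\<^sub>L adj (T a)"]) (simp add: comp_assoc)
    finally show ?thesis by (simp add: comp_assoc)
  qed
  then show ?thesis by (simp add: C_def comp_simps tr_simps)
qed

definition S :: "'s \<Rightarrow>\<^sub>L 's" where "S = (1/2) *\<^sub>R (T H + adj (T H))"

lemma adj_S [simp]: "adj S = S"
  by (simp add: S_def adj_simps add.commute)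

lemma p_S [simp]: "p o\<^sub>L S = S" and S_p [simp]: "S o\<^sub>L p = S"
  by (simp_all add: S_def comp_simps)

lemma S_a: "p x = 0 \<Longrightarrow> S x = 0"
  by (rule comp_p_a) simp

lemma tr_S_C: "tr (S o\<^sub>L C A) = 0"
proof -
  have *: "tr (T H o\<^sub>L C A) = 0" by (intro tr_comp_C T_commute)
  moreover have "tr (adj (T H) o\<^sub>L C A) = 0"
    using * tr_adj[of "T H o\<^sub>L C A"] by (simp add: adj_comp tr_commute)
  ultimately show ?thesis by (simp add: S_def comp_simps tr_simps)
qed

lemma g_S: "z \<in> n \<Longrightarrow> y \<in> n \<Longrightarrow> g (S y) z = (1/2) * (g (br H z) y + g (br H y) z)"
  by (simp add: S_def blinfun.bilinear_simps g.scaleR_left g.add_left adj commute[of y])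

lemma g_C: "g (C A y) z = (\<Sum>a\<in>A. g (adj (T a) y) (adj (T a) z) - g (T a y) (T a z))"
  by (simp add: C_def blinfun.sum_left g.sum_left blinfun.diff_left g.diff_left adj adj')

section \<open>The blocks of the Ricci tensor on \<open>n\<close>, on \<aa> and between them\<close>

lemma ricci_n:
  assumes A: "frame A" and "y \<in> n" "z \<in> n"
  shows "ricci_tensor br g y z = g (((1/2) *\<^sub>R C A - S) y) z
    + (1/4) * (\<Sum>a\<in>A. \<Sum>b\<in>A. g (br a b) y * g (br a b) z)"
proof -
  have "g (br z a) (br y a) = g (T a y) (T a z)" for a
    using assms antisym[of z a] antisym[of y a] commute[of "br a z"]
    by (simp add: g.minus_left g.minus_right)
  then have "g (((1/2) *\<^sub>R C A - S) y) z = - (1/2) * (g (br H z) y + g (br H y) z)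
      + (1/2) * ((\<Sum>a\<in>A. g (adj (T a) y) (adj (T a) z)) - (\<Sum>a\<in>A. g (br z a) (br y a)))"
    using assms by (simp add: blinfun.bilinear_simps g.diff_left g.scaleR_left g_S g_C sum_subtractf
        del: T_apply)
  then show ?thesis
    unfolding ricci_split[OF A] using assms by (simp add: T_n tr_simps adj_simps algebra_simps)
qed

lemma ricci_a:
  assumes A: "frame A" and "p y = 0" "p z = 0"
  shows "ricci_tensor br g y z = - Q y z - (1/2) * (\<Sum>a\<in>A. g (br z a) (br y a))"
  unfolding ricci_split[OF A]
  using assms Q_commute[of y z] by (simp add: g_an adj_T_a g.zero_left Q_def algebra_simps)

lemma ricci_an:
  assumes A: "frame A" and "p y = 0" "z \<in> n"
  shows "ricci_tensor br g y z = (1/2) * ((\<Sum>a\<in>A. g (br a z) (br y a)) - g (br H y) z)"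
proof -
  have "(\<Sum>a\<in>A. g (br z a) (br y a)) = - (\<Sum>a\<in>A. g (br a z) (br y a))"
    using antisym[of z] by (simp add: g.minus_left sum_negf)
  then show ?thesis
    unfolding ricci_split[OF A]
    using assms by (simp add: g_an adj_T_a g.zero_left T_n tr_simps algebra_simps)
qed

end

section \<open>Solvsolitons\<close>

lemma comp_sum_sum: "sum X A o\<^sub>L sum Y B = (\<Sum>a\<in>A. \<Sum>b\<in>B. X a o\<^sub>L Y b)"
  by (simp only: bounded_bilinear.sum_left[OF bounded_bilinear_blinfun_compose]
      bounded_bilinear.sum_right[OF bounded_bilinear_blinfun_compose] sum.swap[of _ B])

lemma tr_comp_sum: "tr (sum X A o\<^sub>L sum Y B) = (\<Sum>a\<in>A. \<Sum>b\<in>B. tr (X a o\<^sub>L Y b))"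
  by (simp only: comp_sum_sum tr_simps)

context split_metric begin

text \<open>
  For commuting operators \<open>T a\<close>, the squared norms of all the commutators \<open>[T a, (T b)\<^sup>t]\<close> add up to
  the squared norm of \<open>\<Sum>a. [T a, (T a)\<^sup>t]\<close>.
\<close>

lemma normal_if_C_0:
  assumes A: "finite A" and C: "C A = 0" and ab: "a \<in> A" "b \<in> A"
  shows "T a o\<^sub>L adj (T b) = adj (T b) o\<^sub>L T a"
proof -
  define K where "K a b = (T a o\<^sub>L adj (T b)) - (adj (T b) o\<^sub>L T a)" for a b
  define P where "P a = T a o\<^sub>L adj (T a)" for a
  define R where "R a = adj (T a) o\<^sub>L T a" for a
  have TT': "adj (T a) o\<^sub>L adj (T b) = adj (T b) o\<^sub>L adj (T a)" for a b
    using arg_cong[OF T_commute[of b a], of adj] by (simp only: adj_comp)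
  have TT3: "T a o\<^sub>L (T b o\<^sub>L X) = T b o\<^sub>L (T a o\<^sub>L X)" for a b X
    using T_commute[of a b] by (metis comp_assoc)
  have TT3': "adj (T a) o\<^sub>L (adj (T b) o\<^sub>L X) = adj (T b) o\<^sub>L (adj (T a) o\<^sub>L X)" for a b X
    using TT'[of a b] by (metis comp_assoc)
  have KK: "tr (K a b o\<^sub>L adj (K a b)) =
      tr (R a o\<^sub>L R b) - tr (P a o\<^sub>L R b) - tr (P a o\<^sub>L R b) + tr (P a o\<^sub>L P b)" for a b
  proof -
    have 1: "tr (T a o\<^sub>L (adj (T b) o\<^sub>L (T b o\<^sub>L adj (T a)))) = tr (R a o\<^sub>L R b)"
      using tr_commute[of "T a" "adj (T b) o\<^sub>L (T b o\<^sub>L adj (T a))"] tr_commute[of "R b" "R a"]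
      by (simp add: R_def comp_assoc)
    have 2: "tr (T a o\<^sub>L (adj (T b) o\<^sub>L (adj (T a) o\<^sub>L T b))) = tr (P a o\<^sub>L R b)"
      unfolding P_def R_def comp_assoc TT3'[of a b] ..
    have 3: "tr (adj (T b) o\<^sub>L (T a o\<^sub>L (T b o\<^sub>L adj (T a)))) = tr (P a o\<^sub>L R b)"
      unfolding P_def R_def TT3[of a b] by (subst (2) tr_commute) (simp add: comp_assoc)
    have 4: "tr (adj (T b) o\<^sub>L (T a o\<^sub>L (adj (T a) o\<^sub>L T b))) = tr (P a o\<^sub>L P b)"
      unfolding P_def comp_assoc by (subst tr_commute) (simp add: comp_assoc)
    have "adj (K a b) = (T b o\<^sub>L adj (T a)) - (adj (T a) o\<^sub>L T b)"
      by (simp add: K_def adj_simps adj_comp)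
    then have "tr (K a b o\<^sub>L adj (K a b)) = tr (T a o\<^sub>L (adj (T b) o\<^sub>L (T b o\<^sub>L adj (T a))))
        - tr (T a o\<^sub>L (adj (T b) o\<^sub>L (adj (T a) o\<^sub>L T b)))
        - tr (adj (T b) o\<^sub>L (T a o\<^sub>L (T b o\<^sub>L adj (T a))))
        + tr (adj (T b) o\<^sub>L (T a o\<^sub>L (adj (T a) o\<^sub>L T b)))"
      by (simp add: K_def comp_simps tr_simps comp_assoc)
    then show ?thesis by (simp only: 1 2 3 4)
  qed
  have "C A = sum P A - sum R A"
    by (simp add: C_def P_def R_def sum_subtractf)
  then have "sum P A = sum R A" using C by simp
  \<comment> \<open>The double sum of the four terms is the squared norm of the difference of
    \<open>sum P A\<close> and \<open>sum R A\<close>, which is \<open>C A\<close>.\<close>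
  have "(\<Sum>a\<in>A. \<Sum>b\<in>A. tr (K a b o\<^sub>L adj (K a b)))
      = tr (sum R A o\<^sub>L sum R A) - tr (sum P A o\<^sub>L sum R A) - tr (sum P A o\<^sub>L sum R A)
        + tr (sum P A o\<^sub>L sum P A)"
    unfolding KK tr_comp_sum by (simp add: sum.distrib sum_subtractf sum_distrib_left sum_negf)
  also have "\<dots> = 0" unfolding \<open>sum P A = sum R A\<close> by simp
  finally have "tr (K a b o\<^sub>L adj (K a b)) = 0"
    using A ab by (simp add: sum_nonneg_eq_0_iff sum_nonneg tr_adj_self_nonneg)
  then show ?thesis using tr_adj_self_eq_0[of "K a b"] by (simp add: K_def)
qed

lemma p_compl [simp]: "p (x - p x) = 0"
  by (simp add: blinfun.diff_right)

lemma T_compl: "T (x - p x) = T x"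
  by (simp add: T_simps T_n)

lemma T_expand:
  assumes "frame A"
  shows "T x = (\<Sum>a\<in>A. g (x - p x) a *\<^sub>R T a)"
proof -
  have "(\<Sum>a\<in>A. g (x - p x) a *\<^sub>R a) = x - p x"
    using assms by (intro onb_expand) (auto simp: frame_def)
  from arg_cong[OF this, of T] show ?thesis by (simp add: T_simps T_n)
qed

lemma normal:
  assumes A: "frame A" and C: "C A = 0"
  shows "T x o\<^sub>L adj (T y) = adj (T y) o\<^sub>L T x"
proof -
  define X where "X x a = g (x - p x) a *\<^sub>R T a" for x a
  have X: "T x = sum (X x) A" for x by (simp add: X_def T_expand[OF A, of x])
  have "X x a o\<^sub>L adj (X y b) = adj (X y b) o\<^sub>L X x a" if "a \<in> A" "b \<in> A" for a b
    using normal_if_C_0[OF finite_frame[OF A] C that]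
    by (simp add: X_def adj_simps comp_simps mult.commute)
  then have "(\<Sum>a\<in>A. \<Sum>b\<in>A. X x a o\<^sub>L adj (X y b)) = (\<Sum>a\<in>A. \<Sum>b\<in>A. adj (X y b) o\<^sub>L X x a)"
    by simp
  also have "\<dots> = (\<Sum>b\<in>A. \<Sum>a\<in>A. adj (X y b) o\<^sub>L X x a)" by (rule sum.swap)
  finally show ?thesis by (simp add: X adj_simps comp_sum_sum)
qed

text \<open>A symmetric derivation has an eigenbasis. If \<open>D b = l *\<^sub>R b\<close> with
  \<open>l \<noteq> 0\<close>, then \<open>ad b\<close> is \<open>1 / l\<close> times the commutator
  of \<open>D\<close> and \<open>ad b\<close>, so it is nilpotent by Jacobson's lemma and
  \<open>b\<close> lies in \<open>n\<close>.\<close>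

lemma derivation_in_n:
  fixes D :: "'s \<Rightarrow>\<^sub>L 's"
  assumes D: "adj D = D" and der: "\<And>x y. D (br x y) = br (D x) y + br x (D y)"
  shows "D x \<in> n"
proof -
  have gD: "g (D x) y = g x (D y)" for x y using adj[of D x y] D by simp
  have "bilinear (\<lambda>x y. g (D x) y)"
    unfolding bilinear_def by (auto intro!: linearI simp: blinfun.bilinear_simps g.add_left
        g.add_right g.scaleR_left g.scaleR_right)
  moreover have "g (D x) y = g (D y) x" for x y using gD[of x y] commute by simp
  ultimately obtain B where B: "onb UNIV B" "\<And>b c. b \<in> B \<Longrightarrow> c \<in> B \<Longrightarrow> b \<noteq> c \<Longrightarrow> g (D b) c = 0"
    using exists_diagonal_onb[of "\<lambda>x y. g (D x) y" UNIV] by auto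
  have eig: "D b = g (D b) b *\<^sub>R b" if "b \<in> B" for b
  proof (rule onb_unique[OF B(1)])
    fix c assume "c \<in> B"
    then show "g (D b) c = g (g (D b) b *\<^sub>R b) c"
      using B that by (cases "b = c") (auto simp: g.scaleR_left onb_def)
  qed
  have "{b \<in> B. D b \<noteq> 0} \<subseteq> n"
  proof (rule subset_nilradical)
    fix b assume "b \<in> {b \<in> B. D b \<noteq> 0}"
    then have b: "b \<in> B" "D b \<noteq> 0" by auto
    define l where "l = g (D b) b"
    have Db: "D b = l *\<^sub>R b" using eig[OF b(1)] by (simp add: l_def)
    have l: "l \<noteq> 0" using b(2) Db by auto
    have "ad b = (1 / l) *\<^sub>R ((D o\<^sub>L ad b) - (ad b o\<^sub>L D))"
      by (intro blinfun_eqI) (simp add: blinfun.bilinear_simps der Db br.scaleR_left l)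
    then have "\<exists>m. opow (ad b) m = 0" by (rule nilpotent_commutator) simp
    then obtain m where m: "opow (ad b) m = 0" by blast
    have "opow (ad b) m v = (br b ^^ m) v" for m v by (induction m) auto
    then show "\<exists>m. \<forall>v\<in>n. (br b ^^ m) v = 0" using m by (metis zero_blinfun.rep_eq)
  qed (auto intro: span_base)
  then have "D b \<in> n" if "b \<in> B" for b
    using eig[OF that] that subspace_scale[OF subspace_n, of b] subspace_0[OF subspace_n]
    by (cases "D b = 0") (auto, metis (mono_tags, lifting) mem_Collect_eq subset_iff)
  then have "D (\<Sum>b\<in>B. g x b *\<^sub>R b) \<in> n"
    by (simp add: blinfun.sum_right blinfun.scaleR_right subspace_sum subspace_scale subspace_n)
  then show ?thesis by (simp add: onb_expand[OF B(1)])
qed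

lemma solvsolitonE:
  assumes "solvsoliton br g"
  obtains c D where "Ric = c *\<^sub>R id_blinfun + D" "\<And>x y. D (br x y) = br (D x) y + br x (D y)"
proof -
  obtain c D where D: "lie_derivation br D" "\<And>x. ricci_operator br g x = c *\<^sub>R x + D x"
    using assms by (auto simp: solvsoliton_def)
  have lin: "blinfun_apply (Blinfun D) = D"
    using D(1) by (intro Blinfun_linear) (simp add: lie_derivation_def)
  have "Ric = c *\<^sub>R id_blinfun + Blinfun D"
    by (intro blinfun_eqI) (simp add: Ric_apply D(2) blinfun.bilinear_simps lin)
  then show ?thesis by (rule that) (use D(1) in \<open>simp add: lin lie_derivation_def\<close>)
qed

definition abelian_compl :: bool where
  "abelian_compl \<longleftrightarrow> (\<forall>x y. p x = 0 \<longrightarrow> p y = 0 \<longrightarrow> br x y = 0)"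

lemma Q_compl: "Q (x - p x) (y - p y) = Q x y"
  by (simp add: Q_def T_compl)

text \<open>Without brackets inside \<aa> the mixed block vanishes. As \<open>C A\<close> and
  \<open>S\<close> live on \<open>n\<close> and \<open>Q\<close> lives on \<aa>, the other two
  blocks combine into one formula.\<close>

lemma ricci_abelian:
  assumes A: "frame A" and ab: "abelian_compl"
  shows "ricci_tensor br g y z = g (((1/2) *\<^sub>R C A - S) y) z - Q y z"
proof -
  let ?r = "ricci_tensor br g" and ?F = "(1/2) *\<^sub>R C A - S"
  note lin = linear_add[OF linear_ricci_tensor]
  have br0: "br a b = 0" if "p a = 0" "p b = 0" for a b
    using ab that by (auto simp: abelian_compl_def)
  have Aa: "p a = 0" if "a \<in> A" for a using frame_a[OF A that] .
  have an: "?r y z = 0" if "p y = 0" "z \<in> n" for y z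
    unfolding ricci_an[OF A that] using that by (simp add: br0 Aa g.zero_left g.zero_right)
  have nn: "?r (p y) (p z) = g (?F (p y)) (p z)"
    by (simp add: ricci_n[OF A] br0 Aa g.zero_left)
  have aa: "?r (y - p y) (z - p z) = - Q y z"
    by (subst ricci_a[OF A]) (simp_all add: br0 Aa g.zero_left Q_compl del: br.diff_left)
  have "?r y z = ?r (y - p y) (z - p z) + ?r (y - p y) (p z) + ?r (z - p z) (p y) + ?r (p y) (p z)"
    using lin[of y "z - p z" "p z"] lin[of "z - p z" "y - p y" "p y"] lin[of "p z" "y - p y" "p y"]
      ricci_tensor_commute[of y "z - p z"] ricci_tensor_commute[of y "p z"]
      ricci_tensor_commute[of "z - p z" "y - p y"] ricci_tensor_commute[of "p z" "y - p y"]
      ricci_tensor_commute[of "p z" "p y"]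
    by simp
  also have "\<dots> = g (?F (p y)) (p z) - Q y z" by (simp add: an nn aa)
  also have "g (?F (p y)) (p z) = g (?F y) z"
  proof -
    have "p o\<^sub>L ?F o\<^sub>L p = ?F" by (simp add: comp_simps)
    then have "?F y = p (?F (p y))" by (metis blinfun_apply_blinfun_compose)
    then show ?thesis by (simp add: g_p)
  qed
  finally show ?thesis .
qed

text \<open>The operator \<open>F\<close> below measures the part of the soliton equation on
  \<open>n\<close> not involving \<open>C A\<close> or [\<aa>, \<aa>]. Its squared norm turns out to
  be nonpositive, so it vanishes and everything else follows.\<close>

lemma soliton_structure:
  assumes A: "frame A" and sol: "Ric = c *\<^sub>R id_blinfun + D"
    and der: "\<And>x y. D (br x y) = br (D x) y + br x (D y)"
  shows "abelian_compl" "C A = 0" "\<And>y z. p y = 0 \<Longrightarrow> p z = 0 \<Longrightarrow> Q y z = - c * g y z"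
proof -
  have D: "adj D = D"
  proof -
    have "D = Ric - c *\<^sub>R id_blinfun" by (simp add: sol)
    moreover have "adj id_blinfun = id_blinfun" by (rule adjI) simp
    ultimately show ?thesis by (simp add: adj_simps adj_Ric)
  qed
  then have gD: "g (D x) y = g x (D y)" for x y using adj[of D x y] by simp
  have Dn: "D x \<in> n" for x by (rule derivation_in_n[OF D der])
  \<comment> \<open>\<open>D\<close> is symmetric with range in \<open>n\<close>, so it kills the
    orthogonal complement of \<open>n\<close>.\<close>
  have Da: "D a = 0" if "p a = 0" for a
  proof -
    have "g (D a) (D a) = g a (D (D a))" by (rule gD)
    also have "\<dots> = 0" using that Dn by (rule g_an(1))
    finally show ?thesis by (simp add: eq_0_iff)
  qed
  have Dp: "D (p x) = D x" for x
    using Da[of "x - p x"] by (simp add: blinfun.diff_right)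
  have Dp' [simp]: "D o\<^sub>L p = D" "p o\<^sub>L D = D"
    by (intro blinfun_eqI; simp add: Dp Dn)+
  have DT: "D o\<^sub>L T a = T a o\<^sub>L D" for a
    by (intro blinfun_eqI) (simp add: der Dp Dn)
  have ric: "ricci_tensor br g y z = c * g y z + g (D y) z" for y z
    by (simp add: g_Ric[symmetric] sol blinfun.bilinear_simps g.add_left g.scaleR_left)
  have Aa: "p a = 0" if "a \<in> A" for a using frame_a[OF A that] .

  define F where "F = c *\<^sub>R p + D + S"
  have F_p [simp]: "F o\<^sub>L p = F" "p o\<^sub>L F = F"
    by (simp_all add: F_def comp_simps) (auto intro!: blinfun_eqI simp: blinfun.bilinear_simps)
  have adjF: "adj F = F" by (simp add: F_def adj_simps D adj_p)
  \<comment> \<open>By the soliton equation and \<open>ricci_n\<close>, this is the contribution of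
    [\<aa>, \<aa>] to the Ricci operator on \<open>n\<close>, extended by zero.\<close>
  define L where "L = F - (1/2) *\<^sub>R C A"
  have Lp: "p o\<^sub>L L o\<^sub>L p = L" by (simp add: L_def comp_simps)
  have gL: "g (L y) z = (1/4) * (\<Sum>a\<in>A. \<Sum>b\<in>A. g (br a b) y * g (br a b) z)" for y z
  proof -
    have gp: "g (br a b) (p x) = g (br a b) x" for a b x
      using g_p[of "br a b" x] by simp
    have "L y = p (L (p y))" using Lp by (metis blinfun_apply_blinfun_compose)
    then have "g (L y) z = g (L (p y)) (p z)" by (simp add: g_p)
    also have "\<dots> = ricci_tensor br g (p y) (p z) - g (((1/2) *\<^sub>R C A - S) (p y)) (p z)"
      by (simp add: L_def F_def ric blinfun.bilinear_simps g.add_left g.diff_left g.scaleR_left)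
    also have "\<dots> = (1/4) * (\<Sum>a\<in>A. \<Sum>b\<in>A. g (br a b) (p y) * g (br a b) (p z))"
      by (simp add: ricci_n[OF A])
    finally show ?thesis by (simp only: gp)
  qed
  have trL: "tr (X o\<^sub>L L) = (1/4) * (\<Sum>a\<in>A. \<Sum>b\<in>A. g (X (br a b)) (br a b))" if "adj X = X" for X
  proof -
    obtain B where B: "onb UNIV B" using exists_onb[of UNIV] by auto
    have gX: "g (X x) y = g x (X y)" for x y using adj[of X x y] that by simp
    have "tr (X o\<^sub>L L) = (\<Sum>i\<in>B. g (L i) (X i))" by (simp add: tr_onb[OF B] gX)
    also have "\<dots> = (1/4) * (\<Sum>a\<in>A. \<Sum>b\<in>A. \<Sum>i\<in>B. g (br a b) (X i) * g i (br a b))"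
      by (simp add: gL sum_distrib_left sum.swap[of _ B] commute mult.commute)
    also have "\<dots> = (1/4) * (\<Sum>a\<in>A. \<Sum>b\<in>A. g (X (br a b)) (br a b))"
      by (simp add: gX[symmetric] onb_parseval[OF B UNIV_I, symmetric])
    finally show ?thesis .
  qed
  have trFC: "tr (F o\<^sub>L C A) = 0"
    using tr_comp_C[of A D, OF DT] by (simp add: F_def comp_simps tr_simps tr_C tr_S_C)

  \<comment> \<open>The soliton equation has no mixed component; it is tested on \<open>b\<close>
    and \<open>br H b\<close>.\<close>
  have mixed: "g (br H b) (br H b) = - (\<Sum>a\<in>A. g (br a (br H b)) (br a b))" if "b \<in> A" for b
  proof -
    have "ricci_tensor br g b (br H b) = 0"
      using that by (simp add: ric Aa Da g_an g.zero_left)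
    then have "g (br H b) (br H b) = (\<Sum>a\<in>A. g (br a (br H b)) (br b a))"
      using ricci_an[OF A Aa[OF that], of "br H b"] by simp
    also have "\<dots> = - (\<Sum>a\<in>A. g (br a (br H b)) (br a b))"
      using antisym[of b] by (simp add: g.minus_right sum_negf)
    finally show ?thesis .
  qed
  \<comment> \<open>The Jacobi identity for \<open>H\<close>, \<open>a\<close>, \<open>b\<close>
    reduces the sum to two copies of the one in \<open>mixed\<close>.\<close>
  have W: "(\<Sum>a\<in>A. \<Sum>b\<in>A. g (br H (br a b)) (br a b)) = - 2 * (\<Sum>b\<in>A. g (br H b) (br H b))"
  proof -
    have "g (br H (br a b)) (br a b) = g (br b (br H a)) (br b a) + g (br a (br H b)) (br a b)" for a b
    proof -
      have "g (br (br H a) b) (br a b) = g (br b (br H a)) (br b a)"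
        by (subst antisym[of "br H a"], subst antisym[of a]) (simp add: g.minus_left g.minus_right)
      then show ?thesis by (simp only: jacobi[of H a b] g.add_left)
    qed
    then have "(\<Sum>a\<in>A. \<Sum>b\<in>A. g (br H (br a b)) (br a b)) =
       (\<Sum>a\<in>A. \<Sum>b\<in>A. g (br b (br H a)) (br b a)) + (\<Sum>a\<in>A. \<Sum>b\<in>A. g (br a (br H b)) (br a b))"
      by (simp add: sum.distrib)
    also have "(\<Sum>a\<in>A. \<Sum>b\<in>A. g (br a (br H b)) (br a b)) = (\<Sum>b\<in>A. \<Sum>a\<in>A. g (br a (br H b)) (br a b))"
      by (rule sum.swap)
    finally show ?thesis using mixed by (simp add: sum_negf)
  qed
  let ?l = "\<Sum>a\<in>A. \<Sum>b\<in>A. g (br a b) (br a b)"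
  have l0: "?l \<ge> 0" by (intro sum_nonneg nonneg)
  \<comment> \<open>\<open>F\<close> is trace-orthogonal to \<open>C A\<close>, which leaves a sum
    over the brackets of \<aa>. \<open>D\<close> kills these, so only \<open>c\<close> and
    \<open>S\<close> contribute.\<close>
  have "tr (F o\<^sub>L F) = tr (F o\<^sub>L L)"
    using trFC by (simp add: L_def comp_simps tr_simps)
  also have "\<dots> = (1/4) * (\<Sum>a\<in>A. \<Sum>b\<in>A. g (F (br a b)) (br a b))" by (rule trL[OF adjF])
  also have "g (F (br a b)) (br a b) = c * g (br a b) (br a b) + g (br H (br a b)) (br a b)"
    if "a \<in> A" "b \<in> A" for a b
    using that by (simp add: F_def blinfun.bilinear_simps g.add_left g.scaleR_left g_S der Da Aa
        br.zero_left br.zero_right)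
  then have "(\<Sum>a\<in>A. \<Sum>b\<in>A. g (F (br a b)) (br a b))
      = c * ?l + (\<Sum>a\<in>A. \<Sum>b\<in>A. g (br H (br a b)) (br a b))"
    by (simp add: sum.distrib sum_distrib_left)
  finally have trFF: "tr (F o\<^sub>L F) = (1/4) * (c * ?l - 2 * (\<Sum>b\<in>A. g (br H b) (br H b)))"
    unfolding W by simp
  \<comment> \<open>\<open>c\<close> is the Ricci curvature of any unit vector in \<aa> and thus
    nonpositive; without such a vector, \<open>?l\<close> is an empty sum.\<close>
  have "c * ?l \<le> 0"
  proof (cases "A = {}")
    case False
    then obtain a where a: "a \<in> A" by blast
    have "c = ricci_tensor br g a a"
      using A a by (simp add: ric Da Aa g.zero_left frame_def onb_def)
    also have "\<dots> \<le> 0"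
      using Q_nonneg[of a] sum_nonneg[of A "\<lambda>x. g (br a x) (br a x)"]
      by (simp add: ricci_a[OF A Aa[OF a] Aa[OF a]] nonneg)
    finally show ?thesis using l0 by (simp add: mult_nonpos_nonneg)
  qed simp
  moreover have "(\<Sum>b\<in>A. g (br H b) (br H b)) \<ge> 0" by (intro sum_nonneg nonneg)
  ultimately have "tr (F o\<^sub>L adj F) = 0"
    using tr_adj_self_nonneg[of F] trFF adjF by simp
  then have F0: "F = 0" by (rule tr_adj_self_eq_0)
  \<comment> \<open>The trace of \<open>L\<close> is a quarter of \<open>?l\<close>, but now
    \<open>L\<close> is a multiple of the traceless \<open>C A\<close>.\<close>
  have "tr L = 0" using F0 by (simp add: L_def tr_simps tr_C)
  then have "?l = 0" using trL[of id_blinfun] adjI[of id_blinfun id_blinfun] by simp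
  then have br0: "br a b = 0" if "a \<in> A" "b \<in> A" for a b
    using that finite_frame[OF A] by (simp add: sum_nonneg_eq_0_iff sum_nonneg nonneg eq_0_iff)
  have "br x y = 0" if "p x = 0" "p y = 0" for x y
    using br_span[of "{0}" x A y A] that A br0 by (auto simp: frame_def onb_def)
  then show ab: "abelian_compl" by (simp add: abelian_compl_def)
  have "L = 0"
    by (intro blinfun_eqI eqI) (simp add: gL br0 g.zero_left)
  then show "C A = 0" using F0 by (simp add: L_def)
  fix y z assume "p y = 0" "p z = 0"
  then show "Q y z = - c * g y z"
    using ric[of y z] by (simp add: ricci_abelian[OF A ab] Da blinfun.bilinear_simps C_a S_a
        g.zero_left)
qed

end

section \<open>Comparison of metrics\<close>

text \<open>With \<open>d\<close> the weighted sum of the squared deviations of \<open>q\<close>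
  from \<open>t\<close>, one has \<open>?s * d = t * (?u * ?v - ?s\<^sup>2)\<close>; equality
  therefore means that \<open>q\<close> is constantly \<open>t\<close>.\<close>

lemma weighted_Cauchy_Schwarz:
  fixes q x :: "'a \<Rightarrow> real"
  assumes "finite A" and q: "\<And>a. a \<in> A \<Longrightarrow> q a > 0" and x: "\<And>a. a \<in> A \<Longrightarrow> x a > 0"
  shows "(\<Sum>a\<in>A. x a)\<^sup>2 \<le> (\<Sum>a\<in>A. q a * x a) * (\<Sum>a\<in>A. x a / q a)"
    and "(\<Sum>a\<in>A. x a)\<^sup>2 = (\<Sum>a\<in>A. q a * x a) * (\<Sum>a\<in>A. x a / q a) \<Longrightarrow> \<exists>t>0. \<forall>a\<in>A. q a = t"
proof -
  let ?s = "\<Sum>a\<in>A. x a" and ?u = "\<Sum>a\<in>A. q a * x a" and ?v = "\<Sum>a\<in>A. x a / q a"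
  \<comment> \<open>The mean of \<open>q\<close> with weights \<open>x\<close>, the only candidate
    for a constant value.\<close>
  define t where "t = ?u / ?s"
  define d where "d = (\<Sum>a\<in>A. x a * (q a - t)\<^sup>2 / q a)"
  have terms: "x a * (q a - t)\<^sup>2 / q a \<ge> 0" if "a \<in> A" for a
    using x[OF that] q[OF that] by simp
  have d0: "d \<ge> 0" unfolding d_def by (intro sum_nonneg terms)
  have "x a * (q a - t)\<^sup>2 / q a = q a * x a - 2 * t * x a + t\<^sup>2 * (x a / q a)" if "a \<in> A" for a
    using q[OF that] by (simp add: power2_eq_square field_simps)
  then have d: "d = ?u - 2 * t * ?s + t\<^sup>2 * ?v"
    unfolding d_def by (simp add: sum.distrib sum_subtractf sum_distrib_left)
  have *: "?s\<^sup>2 \<le> ?u * ?v \<and> (?s\<^sup>2 = ?u * ?v \<longrightarrow> (\<exists>t>0. \<forall>a\<in>A. q a = t))"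
  proof (cases "A = {}")
    case True
    then show ?thesis by (auto intro: exI[of _ 1])
  next
    case False
    have s: "?s > 0" using assms(1) False x by (intro sum_pos) auto
    have u: "?u > 0" using assms(1) False x q by (intro sum_pos) auto
    have t: "t > 0" using s u by (simp add: t_def)
    have "?u = t * ?s" using s by (simp add: t_def)
    then have "?s * d = t * (?u * ?v - ?s\<^sup>2)"
      unfolding d by (simp add: power2_eq_square algebra_simps)
    moreover have "?s * d \<ge> 0" using s d0 by simp
    ultimately have le: "?s\<^sup>2 \<le> ?u * ?v" and eq: "?s\<^sup>2 = ?u * ?v \<Longrightarrow> d = 0"
      using t s by (auto simp: zero_le_mult_iff)
    have "\<forall>a\<in>A. q a = t" if "d = 0"
    proof
      fix a assume a: "a \<in> A"
      have "x a * (q a - t)\<^sup>2 / q a = 0"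
        using that a sum_nonneg_eq_0_iff[OF assms(1) terms] unfolding d_def by auto
      then show "q a = t" using x[OF a] q[OF a] by auto
    qed
    with le eq t show ?thesis by blast
  qed
  show "?s\<^sup>2 \<le> ?u * ?v" using * by blast
  show "\<exists>t>0. \<forall>a\<in>A. q a = t" if "?s\<^sup>2 = ?u * ?v" using * that by blast
qed

context inner_prod begin

lemma onb_card: "onb V B \<Longrightarrow> card B = dim V"
proof -
  assume B: "onb V B"
  then have fin: "finite B" and g: "\<And>b c. b \<in> B \<Longrightarrow> c \<in> B \<Longrightarrow> g b c = (if b = c then 1 else 0)"
    by (auto simp: onb_def)
  have "independent B"
  proof (rule independent_if_scalars_zero[OF fin])
    fix f b assume f: "(\<Sum>x\<in>B. f x *\<^sub>R x) = 0" and b: "b \<in> B"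
    have "0 = g (\<Sum>x\<in>B. f x *\<^sub>R x) b" by (simp add: f g.zero_left)
    also have "\<dots> = (\<Sum>x\<in>B. if x = b then f x else 0)"
      unfolding g.sum_left using b by (intro sum.cong) (auto simp: g.scaleR_left g)
    also have "\<dots> = f b" using fin b by simp
    finally show "f b = 0" by simp
  qed
  then show ?thesis using B by (auto simp: onb_def dim_eq_card_independent)
qed

text \<open>
  The first part is the inequality behind Schur's theorem that a normal operator has the smallest
  norm in its conjugacy class: with \<open>p\<close> the eigenvalues of \<open>g'\<close> relative to \<open>g\<close>, use \<open>t - 1 \<ge> ln t\<close>
  for \<open>t = p c / p b\<close>; by normality, the logarithmic terms add up to zero.
\<close>

lemma normal_norm_le:
  fixes X :: "'s \<Rightarrow>\<^sub>L 's"
  assumes g': "inner_prod g'" and X: "X o\<^sub>L adj X = adj X o\<^sub>L X"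
  shows "tr (X o\<^sub>L adj X) \<le> tr (X o\<^sub>L inner_prod.adj g' X)"
    and "tr (X o\<^sub>L adj X) = tr (X o\<^sub>L inner_prod.adj g' X) \<Longrightarrow> onb UNIV B \<Longrightarrow>
      (\<And>b c. b \<in> B \<Longrightarrow> c \<in> B \<Longrightarrow> b \<noteq> c \<Longrightarrow> g' b c = 0) \<Longrightarrow>
      b \<in> B \<Longrightarrow> c \<in> B \<Longrightarrow> g (X b) c \<noteq> 0 \<Longrightarrow> g' b b = g' c c"
proof -
  interpret g': inner_prod g' by (rule g')
  define x where "x b c = g (X b) c" for b c
  have *: "tr (X o\<^sub>L g'.adj X) - tr (X o\<^sub>L adj X) =
        (\<Sum>b\<in>B. \<Sum>c\<in>B. (x b c)\<^sup>2 * (g' c c / g' b b - 1 - ln (g' c c / g' b b)))"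
      and **: "(x b c)\<^sup>2 * (g' c c / g' b b - 1 - ln (g' c c / g' b b)) \<ge> 0"
      and ***: "(x b c)\<^sup>2 * (g' c c / g' b b - 1 - ln (g' c c / g' b b)) = 0 \<Longrightarrow> x b c \<noteq> 0 \<Longrightarrow> g' b b = g' c c"
    if B: "onb UNIV B" "\<And>b c. b \<in> B \<Longrightarrow> c \<in> B \<Longrightarrow> b \<noteq> c \<Longrightarrow> g' b c = 0"
      and b: "b \<in> B" "c \<in> B" for B b c
  proof -
    have fin: "finite B" using B(1) by (simp add: onb_def)
    have p: "g' b b > 0" if "b \<in> B" for b
    proof (rule g'.pos)
      show "b \<noteq> 0" using B(1) that g.zero_left[of b] by (auto simp: onb_def)
    qed
    have g'_right: "g' u b = g u b * g' b b" if "b \<in> B" for u b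
    proof -
      have "g' u b = g' (\<Sum>c\<in>B. g u c *\<^sub>R c) b" by (simp add: onb_expand[OF B(1)])
      also have "\<dots> = (\<Sum>c\<in>B. if c = b then g u c * g' c c else 0)"
        unfolding g'.g.sum_left using B(2) that by (intro sum.cong) (auto simp: g'.g.scaleR_left)
      finally show ?thesis using fin that by simp
    qed
    have g'_exp: "g' u u = (\<Sum>c\<in>B. (g u c)\<^sup>2 * g' c c)" for u
    proof -
      have "g' u u = g' u (\<Sum>c\<in>B. g u c *\<^sub>R c)" by (simp add: onb_expand[OF B(1)])
      also have "\<dots> = (\<Sum>c\<in>B. (g u c)\<^sup>2 * g' c c)"
        unfolding g'.g.sum_right
      proof (intro sum.cong refl)
        fix c assume "c \<in> B"
        from g'_right[OF this, of u] show "g' u (g u c *\<^sub>R c) = (g u c)\<^sup>2 * g' c c"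
          unfolding g'.g.scaleR_right by (simp add: power2_eq_square)
      qed
      finally show ?thesis .
    qed
    have row: "g (X b) (X b) = (\<Sum>c\<in>B. (x b c)\<^sup>2)" for b
      using onb_parseval[OF B(1) UNIV_I, of "X b" "X b"]
      by (simp add: x_def power2_eq_square commute)
    \<comment> \<open>Normality enters here: it makes the column sums of squares equal to the row
      sums.\<close>
    have col: "g (X b) (X b) = (\<Sum>c\<in>B. (x c b)\<^sup>2)" for b
    proof -
      have "g (X b) (X b) = g (adj X (X b)) b" by (simp add: adj)
      also have "\<dots> = g (X (adj X b)) b"
        using arg_cong[OF X, of "\<lambda>f. blinfun_apply f b"] by simp
      also have "\<dots> = g (adj X b) (adj X b)" by (simp add: adj')
      also have "\<dots> = (\<Sum>c\<in>B. g (adj X b) c * g c (adj X b))" by (rule onb_parseval[OF B(1) UNIV_I])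
      finally show ?thesis by (simp add: adj adj' commute x_def power2_eq_square)
    qed
    have 1: "tr (X o\<^sub>L adj X) = (\<Sum>b\<in>B. \<Sum>c\<in>B. (x b c)\<^sup>2)"
      by (simp add: tr_adj_self[OF B(1)] row)
    have "tr (X o\<^sub>L g'.adj X) = tr (g'.adj X o\<^sub>L X)" by (rule tr_commute)
    also have "\<dots> = (\<Sum>b\<in>B. g (g'.adj X (X b)) b)" by (simp add: tr_onb[OF B(1)])
    also have "\<dots> = (\<Sum>b\<in>B. g' (X b) (X b) / g' b b)"
    proof (intro sum.cong refl)
      fix b assume "b \<in> B"
      then show "g (g'.adj X (X b)) b = g' (X b) (X b) / g' b b"
        using g'_right[of b "g'.adj X (X b)"] p[of b] by (simp add: g'.adj)
    qed
    also have "\<dots> = (\<Sum>b\<in>B. \<Sum>c\<in>B. (x b c)\<^sup>2 * (g' c c / g' b b))"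
      by (simp add: g'_exp[of "X _"] x_def sum_divide_distrib)
    finally have 2: "tr (X o\<^sub>L g'.adj X) = (\<Sum>b\<in>B. \<Sum>c\<in>B. (x b c)\<^sup>2 * (g' c c / g' b b))" .
    have "(\<Sum>b\<in>B. \<Sum>c\<in>B. (x b c)\<^sup>2 * ln (g' c c / g' b b)) =
        (\<Sum>b\<in>B. \<Sum>c\<in>B. (x b c)\<^sup>2 * ln (g' c c)) - (\<Sum>b\<in>B. \<Sum>c\<in>B. (x b c)\<^sup>2 * ln (g' b b))"
      unfolding sum_subtractf[symmetric]
      by (intro sum.cong refl) (simp add: p less_imp_neq[OF p, symmetric] ln_div algebra_simps)
    also have "(\<Sum>b\<in>B. \<Sum>c\<in>B. (x b c)\<^sup>2 * ln (g' c c)) = (\<Sum>c\<in>B. \<Sum>b\<in>B. (x b c)\<^sup>2 * ln (g' c c))"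
      by (rule sum.swap)
    also have "\<dots> = (\<Sum>c\<in>B. g (X c) (X c) * ln (g' c c))"
      by (simp add: col sum_distrib_right)
    also have "(\<Sum>b\<in>B. \<Sum>c\<in>B. (x b c)\<^sup>2 * ln (g' b b)) = (\<Sum>b\<in>B. g (X b) (X b) * ln (g' b b))"
      by (simp add: row sum_distrib_right)
    finally show "tr (X o\<^sub>L g'.adj X) - tr (X o\<^sub>L adj X) =
        (\<Sum>b\<in>B. \<Sum>c\<in>B. (x b c)\<^sup>2 * (g' c c / g' b b - 1 - ln (g' c c / g' b b)))"
      unfolding 1 2 by (simp add: algebra_simps sum.distrib sum_subtractf)
    have r: "g' c c / g' b b > 0" using p b by simp
    show "(x b c)\<^sup>2 * (g' c c / g' b b - 1 - ln (g' c c / g' b b)) \<ge> 0"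
      using ln_le_minus_one[OF r] by (intro mult_nonneg_nonneg) auto
    \<comment> \<open>Since \<open>ln t = t - 1\<close> only at \<open>t = 1\<close>, equality lets
      \<open>X\<close> link only basis vectors of the same \<open>g'\<close>-length.\<close>
    assume "(x b c)\<^sup>2 * (g' c c / g' b b - 1 - ln (g' c c / g' b b)) = 0" "x b c \<noteq> 0"
    then have "ln (g' c c / g' b b) = g' c c / g' b b - 1" by simp
    with r have "g' c c / g' b b = 1" by (rule ln_eq_minus_one)
    then show "g' b b = g' c c" using p[OF b(1)] by simp
  qed
  obtain E where E: "onb UNIV E" "\<And>e c. e \<in> E \<Longrightarrow> c \<in> E \<Longrightarrow> e \<noteq> c \<Longrightarrow> g' e c = 0"
    using exists_diagonal_onb[of g' UNIV] g'.inner_product by (auto simp: inner_product_def)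
  have "tr (X o\<^sub>L g'.adj X) - tr (X o\<^sub>L adj X) \<ge> 0"
  proof (cases "E = {}")
    case True
    then show ?thesis using tr_onb[OF E(1)] by simp
  next
    case False
    then obtain e where e: "e \<in> E" by blast
    have "(\<Sum>e\<in>E. \<Sum>c\<in>E. (x e c)\<^sup>2 * (g' c c / g' e e - 1 - ln (g' c c / g' e e))) \<ge> 0"
      by (intro sum_nonneg **[OF E])
    then show ?thesis using *[OF E e e] by simp
  qed
  then show "tr (X o\<^sub>L adj X) \<le> tr (X o\<^sub>L g'.adj X)" by simp
  show "g' b b = g' c c" if eq: "tr (X o\<^sub>L adj X) = tr (X o\<^sub>L g'.adj X)" and B: "onb UNIV B"
    "\<And>b c. b \<in> B \<Longrightarrow> c \<in> B \<Longrightarrow> b \<noteq> c \<Longrightarrow> g' b c = 0"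
    and b: "b \<in> B" "c \<in> B" and ne: "g (X b) c \<noteq> 0"
  proof (rule ***[OF B b])
    have fin: "finite B" using B(1) by (simp add: onb_def)
    have "(\<Sum>b\<in>B. \<Sum>c\<in>B. (x b c)\<^sup>2 * (g' c c / g' b b - 1 - ln (g' c c / g' b b))) = 0"
      using *[OF B b] eq by simp
    then show "(x b c)\<^sup>2 * (g' c c / g' b b - 1 - ln (g' c c / g' b b)) = 0"
      using fin b by (simp add: sum_nonneg_eq_0_iff sum_nonneg **[OF B])
    show "x b c \<noteq> 0" using ne unfolding x_def .
  qed
qed

end

section \<open>Pulling a solvsoliton back by an automorphism and rescaling it\<close>

lemma lin_trace_conj:
  fixes \<phi> f :: "'s::euclidean_space \<Rightarrow> 's"
  assumes "linear \<phi>" "linear \<psi>" "linear f" "\<And>x. \<psi> (\<phi> x) = x" "\<And>x. \<phi> (\<psi> x) = x"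
  shows "lin_trace (\<lambda>x. \<psi> (f (\<phi> x))) = lin_trace f"
proof -
  let ?B = "Blinfun :: ('s \<Rightarrow> 's) \<Rightarrow> _"
  have "tr (?B \<psi> o\<^sub>L (?B f o\<^sub>L ?B \<phi>)) = tr ((?B f o\<^sub>L ?B \<phi>) o\<^sub>L ?B \<psi>)" by (rule tr_commute)
  then show ?thesis
    unfolding tr_def blinfun_compose.rep_eq comp_def by (simp add: Blinfun_linear assms)
qed

lemma (in metric_lie) linear_levi_civita:
  "linear (\<lambda>x. levi_civita br g x y)" "linear (levi_civita br g x)"
  by (rule linearI; simp add: levi_civita blinfun.bilinear_simps linear_add[OF linear_N]
      linear_cmul[OF linear_N])+

lemma (in metric_lie) linear_curvature: "linear (\<lambda>x. curvature br g x y z)"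
  by (rule linearI) (simp_all add: curvature_def br.add_left br.scaleR_left
      linear_add[OF linear_levi_civita(1)] linear_cmul[OF linear_levi_civita(1)]
      linear_add[OF linear_levi_civita(2)] linear_cmul[OF linear_levi_civita(2)] algebra_simps)

lemma (in metric_lie) koszul:
  "2 * g (levi_civita br g x y) z = g (br x y) z - g (br y z) x + g (br z x) y"
  using antisym[of y x] antisym[of z x] commute[of _ x] commute[of _ y]
  by (simp add: levi_civita N_def blinfun.bilinear_simps g.scaleR_left g.diff_left g.add_left
      g.minus_left adj g.minus_right)

text \<open>Koszul's formula is natural under automorphisms and blind to scaling, so \<phi> carries
  connection, curvature and Ricci tensor over. Only the Ricci operator picks up the factor
  \<open>1 / \<kappa>\<close>, and the derivation is conjugated.\<close>

lemma solvsoliton_pullback: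
  assumes sol: "solvsoliton br g" and lie: "lie_algebra br" and g': "inner_product g'"
    and \<phi>: "lie_automorphism br \<phi>" and \<kappa>: "\<kappa> > 0" and pb: "\<And>x y. g' x y = \<kappa> * g (\<phi> x) (\<phi> y)"
  shows "solvsoliton br g'"
proof -
  interpret G: metric_lie br g
    by unfold_locales (use sol lie in \<open>auto simp: solvsoliton_def\<close>)
  interpret G': metric_lie br g' by unfold_locales (use g' lie in auto)
  define \<psi> where "\<psi> = inv \<phi>"
  have lin: "linear \<phi>" and bij: "bij \<phi>" and hom: "\<And>x y. \<phi> (br x y) = br (\<phi> x) (\<phi> y)"
    using \<phi> by (auto simp: lie_automorphism_def)
  have \<psi>\<phi> [simp]: "\<psi> (\<phi> x) = x" and \<phi>\<psi> [simp]: "\<phi> (\<psi> x) = x" for x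
    using bij by (auto simp: \<psi>_def bij_is_inj bij_is_surj surj_f_inv_f)
  have lin': "linear \<psi>"
    by (rule linearI) (metis \<psi>\<phi> \<phi>\<psi> linear_add[OF lin], metis \<psi>\<phi> \<phi>\<psi> linear_cmul[OF lin])
  have LC: "\<phi> (levi_civita br g' x y) = levi_civita br g (\<phi> x) (\<phi> y)" for x y
  proof (rule G.eqI)
    fix z
    have "\<kappa> * (2 * g (\<phi> (levi_civita br g' x y)) z) = 2 * g' (levi_civita br g' x y) (\<psi> z)"
      by (simp add: pb)
    also have "\<dots> = \<kappa> * (2 * g (levi_civita br g (\<phi> x) (\<phi> y)) z)"
      unfolding G.koszul G'.koszul by (simp add: pb hom algebra_simps)
    finally show "g (\<phi> (levi_civita br g' x y)) z = g (levi_civita br g (\<phi> x) (\<phi> y)) z"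
      using \<kappa> by simp
  qed
  have curv: "curvature br g' x y z = \<psi> (curvature br g (\<phi> x) (\<phi> y) (\<phi> z))" for x y z
  proof -
    have "\<phi> (curvature br g' x y z) = curvature br g (\<phi> x) (\<phi> y) (\<phi> z)"
      by (simp add: curvature_def linear_diff[OF lin] LC hom)
    then show ?thesis by (metis \<psi>\<phi>)
  qed
  have ric: "ricci_tensor br g' y z = ricci_tensor br g (\<phi> y) (\<phi> z)" for y z
    unfolding ricci_tensor_def curv
    by (rule lin_trace_conj[OF lin lin' G.linear_curvature]) simp_all
  have op: "ricci_operator br g' x = (1 / \<kappa>) *\<^sub>R \<psi> (ricci_operator br g (\<phi> x))" for x
  proof (rule G'.eqI)
    fix z
    show "g' (ricci_operator br g' x) z = g' ((1 / \<kappa>) *\<^sub>R \<psi> (ricci_operator br g (\<phi> x))) z"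
      using \<kappa> unfolding G'.g_ricci_operator G'.g.scaleR_left
      by (simp add: pb G.g_ricci_operator ric)
  qed
  obtain c D where D: "lie_derivation br D" "\<And>x. ricci_operator br g x = c *\<^sub>R x + D x"
    using sol by (auto simp: solvsoliton_def)
  define D' where "D' x = (1 / \<kappa>) *\<^sub>R \<psi> (D (\<phi> x))" for x
  have hom': "\<psi> (br x y) = br (\<psi> x) (\<psi> y)" for x y by (metis hom \<psi>\<phi> \<phi>\<psi>)
  have "linear D" and der: "\<And>x y. D (br x y) = br (D x) y + br x (D y)"
    using D(1) by (auto simp: lie_derivation_def)
  then have "linear D'"
    unfolding D'_def by (intro linearI) (simp_all add: linear_add[OF lin] linear_add[OF lin']
        linear_cmul[OF lin] linear_cmul[OF lin'] linear_add[of D] linear_cmul[of D] scaleR_add_right)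
  moreover have "D' (br x y) = br (D' x) y + br x (D' y)" for x y
    unfolding D'_def by (simp add: hom der linear_add[OF lin'] hom' scaleR_add_right
        G.br.scaleR_left G.br.scaleR_right)
  ultimately have "lie_derivation br D'" by (simp add: lie_derivation_def)
  moreover have "ricci_operator br g' x = (c / \<kappa>) *\<^sub>R x + D' x" for x
    by (simp add: op D(2) linear_add[OF lin'] linear_cmul[OF lin'] D'_def scaleR_add_right)
  ultimately show ?thesis using g' by (auto simp: solvsoliton_def)
qed

section \<open>The Ricci pinching functional\<close>

context split_metric begin

lemma bounded_bilinear_Q: "bounded_bilinear Q"
  using bilinear_Q by (simp add: bilinear_conv_bounded_bilinear)

lemma exists_Q_frame: "\<exists>A. frame A \<and> (\<forall>a\<in>A. \<forall>b\<in>A. a \<noteq> b \<longrightarrow> Q a b = 0)"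
  unfolding frame_def by (rule exists_diagonal_onb[OF bilinear_Q Q_commute subspace_a])

lemma H_expand: "frame A \<Longrightarrow> (\<Sum>a\<in>A. \<tau> a *\<^sub>R a) = H"
  using onb_expand[of \<aa> A H] by (simp add: frame_def g_H)

lemma g_H_H:
  assumes "frame A"
  shows "g H H = (\<Sum>a\<in>A. (\<tau> a)\<^sup>2)"
proof -
  have "g H H = (\<Sum>a\<in>A. g H a * g a H)"
    using assms by (intro onb_parseval[of \<aa>]) (auto simp: frame_def)
  also have "\<dots> = (\<Sum>a\<in>A. g H a * g H a)" by (simp only: commute)
  finally show ?thesis by (simp add: g_H power2_eq_square)
qed

lemma Q_diagonal:
  assumes A: "frame A" "\<And>a b. a \<in> A \<Longrightarrow> b \<in> A \<Longrightarrow> a \<noteq> b \<Longrightarrow> Q a b = 0"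
  shows "Q (\<Sum>a\<in>A. u a *\<^sub>R a) (\<Sum>a\<in>A. u a *\<^sub>R a) = (\<Sum>a\<in>A. (u a)\<^sup>2 * Q a a)"
proof -
  interpret Q: bounded_bilinear Q by (rule bounded_bilinear_Q)
  have "Q (\<Sum>a\<in>A. u a *\<^sub>R a) (\<Sum>a\<in>A. u a *\<^sub>R a) = (\<Sum>a\<in>A. \<Sum>b\<in>A. u a * (u b * Q a b))"
    by (simp only: Q.sum_left) (simp add: Q.sum_right Q.scaleR_left Q.scaleR_right sum_distrib_left
        mult.left_commute)
  also have "\<dots> = (\<Sum>a\<in>A. \<Sum>b\<in>A. if b = a then (u a)\<^sup>2 * Q a a else 0)"
    using A(2) by (intro sum.cong refl) (auto simp: power2_eq_square)
  finally show ?thesis using finite_frame[OF A(1)] by simp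
qed

text \<open>\<open>Ric\<close> acts on the frame by \<open>- Q a a\<close> and on \<open>n\<close>
  as \<open>C A / 2 - S\<close>. Here \<open>tr S = g H H\<close>,
  \<open>tr (S o\<^sub>L S) = Q H H\<close>, and the cross term vanishes by
  \<open>tr_S_C\<close>.\<close>

lemma ricci_traces:
  assumes A: "frame A" "\<And>a b. a \<in> A \<Longrightarrow> b \<in> A \<Longrightarrow> a \<noteq> b \<Longrightarrow> Q a b = 0"
    and ab: "abelian_compl"
  shows "scalar_curvature br g = - (\<Sum>a\<in>A. Q a a + (\<tau> a)\<^sup>2)"
    and "ricci_norm_sq br g = (\<Sum>a\<in>A. Q a a * (Q a a + (\<tau> a)\<^sup>2)) + (1/4) * tr (C A o\<^sub>L C A)"
proof -
  obtain M where M: "onb n M" using exists_onb[OF subspace_n] by blast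
  note B = onb_split[OF A(1)[unfolded frame_def] M]
  have fin: "finite A" "finite M" using finite_frame[OF A(1)] M by (auto simp: onb_def)
  have m: "x \<in> n" if "x \<in> M" for x
    using M that span_base[of x M] by (auto simp: onb_def)
  have split: "sum f (A \<union> M) = sum f A + sum f M" for f :: "'s \<Rightarrow> real"
    by (rule sum.union_disjoint[OF fin B(2)])
  define G where "G = (1/2) *\<^sub>R C A - S"
  have ric: "g (Ric y) z = g (G y) z - Q y z" for y z
    by (simp add: g_Ric ricci_abelian[OF A(1) ab] G_def)
  have Q_n: "Q y z = 0" if "y \<in> n \<or> z \<in> n" for y z
    using that by (auto simp: Q_def T_n adj_simps tr_simps)
  have G_a: "G a = 0" if "a \<in> A" for a
    using frame_a[OF A(1) that] by (simp add: G_def blinfun.bilinear_simps C_a S_a)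
  have gA: "g a b = (if a = b then 1 else 0)" if "a \<in> A" "b \<in> A" for a b
    using A(1) that by (auto simp: frame_def onb_def)
  have Ric_a: "Ric a = - Q a a *\<^sub>R a" if a: "a \<in> A" for a
  proof (rule onb_unique[OF B(1)])
    fix b assume b: "b \<in> A \<union> M"
    then have "g a b = (if a = b then 1 else 0)"
      using B(1) a by (auto simp: onb_def)
    moreover have "Q a b = (if a = b then Q a a else 0)"
      using b A(2)[OF a, of b] Q_n[of a b] m[of b] by auto
    ultimately show "g (Ric a) b = g (- Q a a *\<^sub>R a) b"
      by (simp add: ric G_a[OF a] g.zero_left g.minus_left g.scaleR_left)
  qed
  have Ric_m: "Ric x = G x" if "x \<in> M" for x
    by (rule eqI) (simp add: ric Q_n m[OF that])
  have trS: "tr S = (\<Sum>a\<in>A. (\<tau> a)\<^sup>2)"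
  proof -
    have "tr S = \<tau> H" by (simp add: S_def tr_simps tr_adj \<tau>_T)
    also have "\<dots> = g H H" by (simp add: g_H)
    finally show ?thesis by (simp add: g_H_H[OF A(1)])
  qed
  have "tr Ric = (\<Sum>a\<in>A. - Q a a) + (\<Sum>x\<in>M. g (G x) x)"
    unfolding tr_onb[OF B(1)] split by (simp add: Ric_a Ric_m g.minus_left g.scaleR_left gA)
  also have "(\<Sum>x\<in>M. g (G x) x) = tr G"
    unfolding tr_onb[OF B(1)] split by (simp add: G_a g.zero_left)
  also have "tr G = - tr S" by (simp add: G_def tr_simps tr_C)
  finally show "scalar_curvature br g = - (\<Sum>a\<in>A. Q a a + (\<tau> a)\<^sup>2)"
    by (simp add: scalar_curvature_Ric trS sum.distrib sum_negf)
  have adjG: "adj G = G" by (simp add: G_def adj_simps)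
  have trSS: "tr (S o\<^sub>L S) = (\<Sum>a\<in>A. (\<tau> a)\<^sup>2 * Q a a)"
  proof -
    have "tr (S o\<^sub>L S) = tr (S o\<^sub>L adj S)" by simp
    also have "\<dots> = Q H H"
    proof -
      have "tr (((1/2) *\<^sub>R X) o\<^sub>L adj ((1/2) *\<^sub>R X)) = (1/4) * tr (X o\<^sub>L adj X)" for X
        by (simp add: comp_simps tr_simps linear_cmul[OF linear_adj])
      then show ?thesis unfolding S_def Q_sym .
    qed
    also have "\<dots> = (\<Sum>a\<in>A. (\<tau> a)\<^sup>2 * Q a a)"
      using Q_diagonal[OF A, of \<tau>] by (simp add: H_expand[OF A(1)])
    finally show ?thesis .
  qed
  have "tr (Ric o\<^sub>L adj Ric) = (\<Sum>a\<in>A. Q a a * Q a a) + (\<Sum>x\<in>M. g (G x) (G x))"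
    unfolding tr_adj_self[OF B(1)] split
    by (simp add: Ric_a Ric_m g.minus_left g.minus_right g.scaleR_left g.scaleR_right gA)
  also have "(\<Sum>x\<in>M. g (G x) (G x)) = tr (G o\<^sub>L adj G)"
    unfolding tr_adj_self[OF B(1)] split by (simp add: G_a g.zero_left)
  also have "tr (G o\<^sub>L adj G) = (1/4) * tr (C A o\<^sub>L C A) + tr (S o\<^sub>L S)"
    unfolding adjG using tr_S_C[of A] tr_commute[of S "C A"]
    by (simp add: G_def comp_simps tr_simps)
  finally show "ricci_norm_sq br g = (\<Sum>a\<in>A. Q a a * (Q a a + (\<tau> a)\<^sup>2)) + (1/4) * tr (C A o\<^sub>L C A)"
    by (simp add: ricci_norm_sq_Ric adj_Ric trSS sum.distrib distrib_left mult.commute)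
qed

lemma pinching_soliton:
  assumes A: "frame A" and ab: "abelian_compl" and C: "C A = 0" and c: "c < 0"
    and Q: "\<And>y z. p y = 0 \<Longrightarrow> p z = 0 \<Longrightarrow> Q y z = - c * g y z"
  shows "ricci_pinching br g = real (dim \<aa>) + g H H / (- c)"
proof -
  have gA: "g a b = (if a = b then 1 else 0)" if "a \<in> A" "b \<in> A" for a b
    using A that by (auto simp: frame_def onb_def)
  have QA: "Q a b = (if a = b then - c else 0)" if "a \<in> A" "b \<in> A" for a b
    using that frame_a[OF A] by (simp add: Q gA)
  have diag: "Q a b = 0" if "a \<in> A" "b \<in> A" "a \<noteq> b" for a b using that by (simp add: QA)
  define u where "u = - c * real (dim \<aa>) + g H H"
  have card: "card A = dim \<aa>" using A onb_card by (simp add: frame_def)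
  have sc: "scalar_curvature br g = - u"
    by (simp add: ricci_traces(1)[OF A diag ab] QA u_def sum.distrib card g_H_H[OF A] sum_subtractf)
  have "ricci_norm_sq br g = (\<Sum>a\<in>A. - c * (- c + (\<tau> a)\<^sup>2))"
    by (simp add: ricci_traces(2)[OF A diag ab] QA C tr_simps)
  also have "\<dots> = - c * u"
    unfolding sum_distrib_left[symmetric] by (simp add: u_def sum.distrib card g_H_H[OF A] sum_subtractf)
  finally have "ricci_pinching br g = u\<^sup>2 / (- c * u)"
    by (simp add: ricci_pinching_def sc)
  \<comment> \<open>For \<open>u = 0\<close> both sides are \<open>0\<close> by the convention for
    division.\<close>
  also have "\<dots> = u / (- c)" by (simp add: power2_eq_square)
  also have "\<dots> = real (dim \<aa>) + g H H / (- c)" using c by (simp add: u_def field_simps)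
  finally show ?thesis .
qed

text \<open>If \<open>c \<ge> 0\<close>, then \<open>Q \<ge> 0\<close> and \<open>Q = - c g\<close>
  force \<open>Q = 0\<close>, hence \<open>S = 0\<close>; together with \<open>C A = 0\<close> this
  makes the metric Ricci flat.\<close>

lemma soliton_constant_neg:
  assumes A: "frame A" and ab: "abelian_compl" and C: "C A = 0"
    and Q: "\<And>y z. p y = 0 \<Longrightarrow> p z = 0 \<Longrightarrow> Q y z = - c * g y z"
    and nonflat: "\<not> ricci_flat br g"
  shows "c < 0"
proof (rule ccontr)
  assume "\<not> c < 0"
  have Q0: "Q y z = 0" for y z
  proof -
    let ?u = "y - p y"
    have "- c * g ?u ?u \<ge> 0" using Q_nonneg[of ?u] Q[of ?u ?u] by simp
    moreover have "c * g ?u ?u \<ge> 0" using \<open>\<not> c < 0\<close> nonneg[of ?u] by simp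
    ultimately have "c = 0 \<or> ?u = 0" using eq_0_iff[of ?u] by auto
    then have "- c * g ?u (z - p z) = 0" by (auto simp: g.zero_left)
    then show ?thesis using Q[of ?u "z - p z"] by (simp add: Q_compl)
  qed
  have "T H + adj (T H) = 0"
    using Q0[of H H] by (intro tr_adj_self_eq_0) (simp add: Q_sym)
  then have "S = 0" by (simp add: S_def)
  then have "Ric = 0"
    by (intro blinfun_eqI eqI) (simp add: g_Ric ricci_abelian[OF A ab] Q0 C g.zero_left)
  with nonflat show False by (simp add: ricci_flat_iff)
qed

end

text \<open>\<open>g\<close> is the solvsoliton and \<open>g'\<close> a competitor.
  \<open>T\<close>, \<tau> and \<open>abelian_compl\<close> depend on the bracket and
  \<open>p\<close> only, so both metrics share them, whereas \<open>adj\<close>, \<open>Q\<close>,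
  \<open>C\<close> and \<open>H\<close> differ.\<close>

locale soliton_pair = G: split_metric br n p g + G': split_metric br n p g'
  for br :: "'s::euclidean_space \<Rightarrow> 's \<Rightarrow> 's" and n :: "'s set" and p :: "'s \<Rightarrow>\<^sub>L 's"
    and g g' :: "'s \<Rightarrow> 's \<Rightarrow> real" +
  fixes c :: real
  assumes ab: "G.abelian_compl" and c: "c < 0"
    and normal: "\<And>x. G.T x o\<^sub>L G.adj (G.T x) = G.adj (G.T x) o\<^sub>L G.T x"
    and Q: "\<And>y z. p y = 0 \<Longrightarrow> p z = 0 \<Longrightarrow> G.Q y z = - c * g y z"
    and nonflat': "\<not> ricci_flat br g'"
begin

definition K :: real where "K = real (dim {x. p x = 0}) + g G.H G.H / (- c)"

text \<open>The metric-dependent trace in \<open>Q x x\<close> is smallest for \<open>g\<close>,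
  because \<open>T x\<close> is normal there.\<close>

lemma Q_le: "G.Q x x \<le> G'.Q x x"
  using G.normal_norm_le(1)[OF G'.inner_prod_axioms normal[of x]] by (simp add: G.Q_def G'.Q_def)

lemma Q'_pos: "p x = 0 \<Longrightarrow> x \<noteq> 0 \<Longrightarrow> G'.Q x x > 0"
  using Q_le[of x] Q[of x x] G.pos[of x] c by (smt (verit) mult_pos_pos)

text \<open>With \<open>x\<close> the summands of \<open>- scal\<close>, the chain is
  \<open>(sum x A)\<^sup>2 \<le> W * K' \<le> N * K' \<le> N * K\<close>: first Cauchy-Schwarz, then
  dropping the norm of \<open>C\<close>, then monotonicity in \<open>Q\<close>. Equality with
  \<open>K\<close> makes every link an equality.\<close>

lemma pinching_bounds:
  assumes A: "G'.frame A" "\<And>a b. a \<in> A \<Longrightarrow> b \<in> A \<Longrightarrow> a \<noteq> b \<Longrightarrow> G'.Q a b = 0"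
  shows "ricci_pinching br g' \<le> K"
    and "ricci_pinching br g' = K \<Longrightarrow> G'.C A = 0 \<and> (\<exists>t>0. \<forall>a\<in>A. G'.Q a a = t)"
proof -
  let ?q = "\<lambda>a. G'.Q a a"
  define x where "x a = ?q a + (G'.\<tau> a)\<^sup>2" for a
  have fin: "finite A" by (rule G'.finite_frame[OF A(1)])
  have q: "?q a > 0" if "a \<in> A" for a
  proof (rule Q'_pos)
    show "p a = 0" by (rule G'.frame_a[OF A(1) that])
    have "g' a a = 1" using A(1) that by (simp add: G'.frame_def G'.onb_def)
    then show "a \<noteq> 0" by (auto simp: G'.g.zero_left)
  qed
  have x: "x a > 0" if "a \<in> A" for a using q[OF that] by (simp add: x_def add_pos_nonneg)
  define K' where "K' = (\<Sum>a\<in>A. x a / ?q a)"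
  define W where "W = (\<Sum>a\<in>A. ?q a * x a)"
  define N where "N = ricci_norm_sq br g'"
  have N: "N > 0" unfolding N_def by (rule G'.ricci_norm_sq_pos[OF nonflat'])
  have NW: "N = W + (1/4) * tr (G'.C A o\<^sub>L G'.C A)"
    by (simp add: N_def W_def x_def G'.ricci_traces(2)[OF A ab])
  have CC: "tr (G'.C A o\<^sub>L G'.C A) \<ge> 0" "tr (G'.C A o\<^sub>L G'.C A) = 0 \<Longrightarrow> G'.C A = 0"
    using G'.tr_adj_self_nonneg[of "G'.C A"] G'.tr_adj_self_eq_0[of "G'.C A"] by simp_all
  have sc: "(scalar_curvature br g')\<^sup>2 = (\<Sum>a\<in>A. x a)\<^sup>2"
    by (simp add: x_def G'.ricci_traces(1)[OF A ab])
  have CS: "(\<Sum>a\<in>A. x a)\<^sup>2 \<le> W * K'"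
    "(\<Sum>a\<in>A. x a)\<^sup>2 = W * K' \<Longrightarrow> \<exists>t>0. \<forall>a\<in>A. ?q a = t"
    unfolding W_def K'_def using weighted_Cauchy_Schwarz[where A = A and q = ?q and x = x] fin q x
    by blast+
  have K'K: "K' \<le> K"
  proof -
    \<comment> \<open>\<open>Z\<close> represents \<tau> on \<aa> with respect to
      \<open>G'.Q\<close>, so \<open>t\<close> is the squared dual norm of \<tau>.\<close>
    define Z where "Z = (\<Sum>a\<in>A. (G'.\<tau> a / ?q a) *\<^sub>R a)"
    have pZ: "p Z = 0"
      by (simp add: Z_def blinfun.sum_right blinfun.scaleR_right G'.frame_a[OF A(1)])
    define t where "t = (\<Sum>a\<in>A. (G'.\<tau> a)\<^sup>2 / ?q a)"
    have \<tau>Z: "G'.\<tau> Z = t"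
      by (simp add: Z_def t_def linear_sum[OF G'.linear_\<tau>] linear_cmul[OF G'.linear_\<tau>] power2_eq_square)
    have "G'.Q Z Z = t"
    proof -
      have "G'.Q Z Z = (\<Sum>a\<in>A. (G'.\<tau> a / ?q a)\<^sup>2 * ?q a)"
        unfolding Z_def by (rule G'.Q_diagonal[OF A])
      also have "\<dots> = t"
        unfolding t_def using q
        by (intro sum.cong refl) (simp add: power2_eq_square less_imp_neq[symmetric])
      finally show ?thesis .
    qed
    then have gZ: "- c * g Z Z \<le> t" using Q_le[of Z] Q[OF pZ pZ] by simp
    have "t \<le> g G.H G.H / (- c)"
    proof -
      \<comment> \<open>Nonnegativity of this square compares the dual norms for \<open>G'.Q\<close>
        and \<open>- c g\<close>; it uses only that \<open>- c * g Z Z \<le> t\<close>.\<close>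
      let ?y = "G.H - (- c) *\<^sub>R Z"
      have gHZ: "g G.H Z = t" using \<tau>Z by (simp add: G.g_H)
      have "0 \<le> g ?y ?y" by (rule G.nonneg)
      also have "g ?y ?y = g G.H G.H - 2 * (- c) * t + (- c) * (- c * g Z Z)"
        using gHZ G.commute[of Z G.H]
        by (simp add: G.g.diff_left G.g.diff_right G.g.add_left G.g.add_right G.g.scaleR_left
            G.g.scaleR_right algebra_simps)
      also have "\<dots> \<le> g G.H G.H - 2 * (- c) * t + (- c) * t"
        using gZ c by (intro add_left_mono mult_left_mono) auto
      finally show ?thesis using c by (simp add: field_simps)
    qed
    moreover have "K' = real (card A) + t"
    proof -
      have "x a / ?q a = 1 + (G'.\<tau> a)\<^sup>2 / ?q a" if "a \<in> A" for a
        using q[OF that] by (simp add: x_def add_divide_distrib)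
      then show ?thesis by (simp add: K'_def t_def sum.distrib)
    qed
    moreover have "card A = dim {x. p x = 0}" using A(1) G'.onb_card by (simp add: G'.frame_def)
    ultimately show ?thesis by (simp add: K_def)
  qed
  have WN: "W \<le> N" using NW CC(1) by simp
  have K'0: "K' \<ge> 0" unfolding K'_def using q x by (intro sum_nonneg divide_nonneg_pos) (auto intro: less_imp_le)
  have 1: "W * K' \<le> N * K'" "N * K' \<le> N * K"
    using WN K'0 K'K N by (auto intro: mult_right_mono mult_left_mono)
  have F: "ricci_pinching br g' = (\<Sum>a\<in>A. x a)\<^sup>2 / N"
    by (simp add: ricci_pinching_def sc N_def)
  show "ricci_pinching br g' \<le> K"
    unfolding F pos_divide_le_eq[OF N] mult.commute[of K] using CS(1) 1 by linarith
  assume "ricci_pinching br g' = K"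
  then have "(\<Sum>a\<in>A. x a)\<^sup>2 = N * K" unfolding F using N by (simp add: field_simps)
  then have eq: "(\<Sum>a\<in>A. x a)\<^sup>2 = W * K'" "W * K' = N * K'" using CS(1) 1 by linarith+
  \<comment> \<open>Otherwise \<open>g'\<close> would be Ricci flat; nonemptiness makes
    \<open>K'\<close> positive, so that it can be cancelled.\<close>
  have "A \<noteq> {}"
  proof
    assume "A = {}"
    then have "N = 0" unfolding NW by (simp add: W_def G'.C_def tr_simps)
    with N show False by simp
  qed
  then have "K' > 0" unfolding K'_def using fin q x by (intro sum_pos) auto
  then have "W = N" using eq(2) by simp
  then have "G'.C A = 0" using NW CC(2) by simp
  with CS(2) eq(1) show "G'.C A = 0 \<and> (\<exists>t>0. \<forall>a\<in>A. ?q a = t)" by blast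
qed

lemma maximum_homothetic:
  assumes "ricci_pinching br g' = K"
  shows "\<exists>\<kappa> \<phi>. \<kappa> > 0 \<and> lie_automorphism br \<phi> \<and> (\<forall>x y. g' x y = \<kappa> * g (\<phi> x) (\<phi> y))"
proof -
  obtain A where A: "G'.frame A" "\<And>a b. a \<in> A \<Longrightarrow> b \<in> A \<Longrightarrow> a \<noteq> b \<Longrightarrow> G'.Q a b = 0"
    using G'.exists_Q_frame by auto
  from pinching_bounds(2)[OF A assms] obtain t where
    C': "G'.C A = 0" and t: "t > 0" "\<And>a. a \<in> A \<Longrightarrow> G'.Q a a = t" by auto
  have normal': "G.T x o\<^sub>L G'.adj (G.T x) = G'.adj (G.T x) o\<^sub>L G.T x" for x
    by (rule G'.normal[OF A(1) C'])
  \<comment> \<open>The operators are normal for both metrics, so the minimality inequality holds in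
    both directions.\<close>
  have norm_eq: "tr (G.T x o\<^sub>L G.adj (G.T x)) = tr (G.T x o\<^sub>L G'.adj (G.T x))" for x
    using G.normal_norm_le(1)[OF G'.inner_prod_axioms normal[of x]]
      G'.normal_norm_le(1)[OF G.inner_prod_axioms normal'[of x]] by simp
  \<comment> \<open>On \<aa>, \<open>G.Q\<close> is \<open>- c g\<close>, \<open>G'.Q\<close> is
    \<open>t g'\<close>, and the two agree.\<close>
  define \<kappa> where "\<kappa> = - c / t"
  have \<kappa>: "\<kappa> > 0" using c t(1) by (simp add: \<kappa>_def divide_neg_pos)
  have ga: "g' x x = \<kappa> * g x x" if x: "p x = 0" for x
  proof -
    have exp: "(\<Sum>a\<in>A. g' x a *\<^sub>R a) = x"
      using A(1) x by (intro G'.onb_expand[of "{x. p x = 0}"]) (auto simp: G'.frame_def)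
    have "- c * g x x = G.Q x x" using Q[OF x x] by simp
    also have "\<dots> = G'.Q x x" using norm_eq[of x] by (simp add: G.Q_def G'.Q_def)
    also have "\<dots> = (\<Sum>a\<in>A. (g' x a)\<^sup>2 * t)"
      using G'.Q_diagonal[OF A, of "g' x"] by (simp add: exp t(2))
    also have "\<dots> = t * (\<Sum>a\<in>A. g' x a * g' a x)"
      using G'.commute[of x] by (simp add: power2_eq_square sum_distrib_left mult.commute)
    also have "(\<Sum>a\<in>A. g' x a * g' a x) = g' x x"
      using A(1) x by (intro G'.onb_parseval[symmetric]) (auto simp: G'.frame_def)
    finally show ?thesis using t(1) by (simp add: \<kappa>_def field_simps)
  qed
  have polar: "g' x y = \<kappa> * g x y" if "p x = 0" "p y = 0" for x y
  proof -
    have "p (x + y) = 0" using that by (simp add: blinfun.add_right)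
    from ga[OF this] show ?thesis
      using ga[OF that(1)] ga[OF that(2)] G.commute[of y x] G'.commute[of y x]
      by (simp add: G.g.add_left G.g.add_right G'.g.add_left G'.g.add_right algebra_simps)
  qed
  \<comment> \<open>\<open>M\<close> consists of eigenvectors of the operator \<open>P\<close>
    relating \<open>g'\<close> to \<open>g\<close> on \<open>n\<close>.\<close>
  obtain M where M: "G.onb n M" "\<forall>a\<in>M. \<forall>b\<in>M. a \<noteq> b \<longrightarrow> g' a b = 0"
    using G.exists_diagonal_onb[of g' n] G'.inner_product G.subspace_n
    by (auto simp: inner_product_def)
  \<comment> \<open>This completes \<open>M\<close> to a basis of the whole space, as
    \<open>normal_norm_le\<close> requires.\<close>
  obtain E where E: "G.onb {x. p x = 0} E" "\<forall>a\<in>E. \<forall>b\<in>E. a \<noteq> b \<longrightarrow> g' a b = 0"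
    using G.exists_diagonal_onb[of g' "{x. p x = 0}"] G'.inner_product G.subspace_a
    by (auto simp: inner_product_def)
  have Mn: "m \<in> n" if "m \<in> M" for m
    using M(1) that span_base[of m M] by (auto simp: G.onb_def)
  have Ea: "p e = 0" if "e \<in> E" for e
    using E(1) that span_base[of e E] by (auto simp: G.onb_def)
  have fin: "finite M" using M(1) by (simp add: G.onb_def)
  have EM: "G.onb UNIV (E \<union> M)" by (rule G.onb_split(1)[OF E(1) M(1)])
  have diag: "g' b d = 0" if "b \<in> E \<union> M" "d \<in> E \<union> M" "b \<noteq> d" for b d
    using that M(2) E(2) Mn Ea G'.g_an by auto
  have gM: "g a b = (if a = b then 1 else 0)" if "a \<in> M" "b \<in> M" for a b
    using M(1) that by (auto simp: G.onb_def)
  \<comment> \<open>The equality case says that every \<open>T x\<close> preserves the eigenspaces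
    of \<open>P\<close>.\<close>
  have eig: "g' m m = g' k k" if "m \<in> M" "k \<in> M" "g (br x m) k \<noteq> 0" for m k x
    using G.normal_norm_le(2)[OF G'.inner_prod_axioms normal[of x] norm_eq EM diag, of m k] that
    by (simp add: Mn)
  define s where "s m = sqrt (g' m m / \<kappa>)" for m
  define \<sigma> where "\<sigma> v = (\<Sum>m\<in>M. (s m * g v m) *\<^sub>R m)" for v
  define \<phi> where "\<phi> x = (x - p x) + \<sigma> (p x)" for x
  have lin\<sigma>: "linear \<sigma>"
    by (rule linearI) (simp_all add: \<sigma>_def G.g.add_left G.g.scaleR_left distrib_left
        scaleR_add_left sum.distrib scaleR_sum_right mult.left_commute)
  have \<sigma>n: "\<sigma> v \<in> n" for v
    unfolding \<sigma>_def using Mn G.subspace_n by (intro subspace_sum subspace_scale) auto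
  have expM: "(\<Sum>m\<in>M. g v m *\<^sub>R m) = v" if "v \<in> n" for v
    by (rule G.onb_expand[OF M(1) that])
  have \<sigma>m: "\<sigma> m = s m *\<^sub>R m" if "m \<in> M" for m
  proof -
    have "\<sigma> m = (\<Sum>k\<in>M. if k = m then s m *\<^sub>R m else 0)"
      unfolding \<sigma>_def using that by (intro sum.cong) (auto simp: gM)
    then show ?thesis using fin that by simp
  qed
  have br\<sigma>: "\<sigma> (br x v) = br x (\<sigma> v)" if "v \<in> n" for x v
  proof -
    have *: "\<sigma> (br x m) = br x (\<sigma> m)" if m: "m \<in> M" for m
    proof -
      have "\<sigma> (br x m) = (\<Sum>k\<in>M. s m *\<^sub>R (g (br x m) k *\<^sub>R k))"
        unfolding \<sigma>_def
      proof (intro sum.cong refl)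
        fix k assume "k \<in> M"
        then show "(s k * g (br x m) k) *\<^sub>R k = s m *\<^sub>R (g (br x m) k *\<^sub>R k)"
          using eig[OF m, of k x] by (cases "g (br x m) k = 0") (auto simp: s_def)
      qed
      also have "\<dots> = s m *\<^sub>R br x m" using expM[of "br x m"] m Mn by (simp only: scaleR_sum_right[symmetric] G.br_n)
      finally show ?thesis by (simp add: \<sigma>m[OF m] G.br.scaleR_right)
    qed
    have "\<sigma> (br x (\<Sum>m\<in>M. g v m *\<^sub>R m)) = br x (\<sigma> (\<Sum>m\<in>M. g v m *\<^sub>R m))"
      by (simp add: G.br.sum_right G.br.scaleR_right linear_sum[OF lin\<sigma>] linear_cmul[OF lin\<sigma>] *)
    then show ?thesis by (simp add: expM that)
  qed
  have lin\<phi>: "linear \<phi>"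
    by (rule linearI) (simp_all add: \<phi>_def blinfun.bilinear_simps linear_add[OF lin\<sigma>]
        linear_cmul[OF lin\<sigma>] algebra_simps)
  have g\<sigma>: "g' v w = \<kappa> * g (\<sigma> v) (\<sigma> w)" if "v \<in> n" "w \<in> n" for v w
  proof -
    have base: "g' m k = \<kappa> * g (\<sigma> m) (\<sigma> k)" if "m \<in> M" "k \<in> M" for m k
    proof (cases "m = k")
      case True
      have "s m * s m = g' m m / \<kappa>" using G'.nonneg[of m] \<kappa> by (simp add: s_def)
      then show ?thesis using \<kappa> True that
        by (simp add: \<sigma>m gM G.g.scaleR_left G.g.scaleR_right)
    next
      case False
      then show ?thesis using M(2) that by (simp add: \<sigma>m gM G.g.scaleR_left G.g.scaleR_right)
    qed
    have "g' (\<Sum>m\<in>M. g v m *\<^sub>R m) (\<Sum>k\<in>M. g w k *\<^sub>R k)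
        = \<kappa> * g (\<sigma> (\<Sum>m\<in>M. g v m *\<^sub>R m)) (\<sigma> (\<Sum>k\<in>M. g w k *\<^sub>R k))"
      unfolding linear_sum[OF lin\<sigma>] linear_cmul[OF lin\<sigma>] G.g.sum_left G'.g.sum_left
        G.g.sum_right G'.g.sum_right G.g.scaleR_left G.g.scaleR_right G'.g.scaleR_left
        G'.g.scaleR_right sum_distrib_left
      by (intro sum.cong refl) (simp add: base sum_distrib_left mult.left_commute)
    then show ?thesis by (simp add: expM that)
  qed
  have pb: "g' x y = \<kappa> * g (\<phi> x) (\<phi> y)" for x y
  proof -
    have "g' x y = g' ((x - p x) + p x) ((y - p y) + p y)" by simp
    also have "\<dots> = g' (x - p x) (y - p y) + g' (p x) (p y)"
      unfolding G'.g.add_left G'.g.add_right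
      using G'.g_an[of "x - p x" "p y"] G'.g_an[of "y - p y" "p x"] by simp
    also have "\<dots> = \<kappa> * (g (x - p x) (y - p y) + g (\<sigma> (p x)) (\<sigma> (p y)))"
      using polar[of "x - p x" "y - p y"] g\<sigma>[of "p x" "p y"] by (simp add: distrib_left)
    also have "g (x - p x) (y - p y) + g (\<sigma> (p x)) (\<sigma> (p y)) = g (\<phi> x) (\<phi> y)"
      unfolding \<phi>_def G.g.add_left G.g.add_right
      using G.g_an[of "x - p x" "\<sigma> (p y)"] G.g_an[of "y - p y" "\<sigma> (p x)"] \<sigma>n by simp
    finally show ?thesis .
  qed
  have "inj \<phi>"
  proof (subst linear_injective_0[OF lin\<phi>], intro allI impI)
    fix x assume "\<phi> x = 0"
    then have "g' x x = 0" by (simp add: pb G.g.zero_left)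
    then show "x = 0" by (simp add: G'.eq_0_iff)
  qed
  then have "bij \<phi>"
    using linear_injective_imp_surjective[OF lin\<phi>] by (simp add: bij_def)
  moreover have "\<phi> (br x y) = br (\<phi> x) (\<phi> y)" for x y
  proof -
    \<comment> \<open>Brackets inside \<aa> and inside \<open>n\<close> vanish, so only the action
      of \<aa> on \<open>n\<close> matters; \<phi> fixes \<aa>-components and \<sigma> commutes with
      this action.\<close>
    have dec: "br u v = br (u - p u) (p v) - br (v - p v) (p u)" for u v
    proof -
      have "br u v = br ((u - p u) + p u) ((v - p v) + p v)" by simp
      also have "\<dots> = br (u - p u) (p v) + br (p u) (v - p v)"
        unfolding G.br.add_left G.br.add_right
        using ab by (simp add: G.abelian_compl_def del: G.br.diff_left)
      finally show ?thesis using G.antisym[of "p u" "v - p v"] by simp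
    qed
    have p\<phi>: "p (\<phi> u) = \<sigma> (p u)" "\<phi> u - p (\<phi> u) = u - p u" for u
      by (simp_all add: \<phi>_def blinfun.bilinear_simps \<sigma>n)
    have "\<phi> (br x y) = \<sigma> (br x y)" by (simp add: \<phi>_def)
    also have "\<dots> = br (x - p x) (\<sigma> (p y)) - br (y - p y) (\<sigma> (p x))"
      unfolding dec[of x y] by (simp add: linear_diff[OF lin\<sigma>] br\<sigma>)
    also have "\<dots> = br (\<phi> x) (\<phi> y)"
      unfolding dec[of "\<phi> x" "\<phi> y"] p\<phi>(2) unfolding p\<phi>(1) ..
    finally show ?thesis .
  qed
  ultimately have "lie_automorphism br \<phi>" using lin\<phi> by (simp add: lie_automorphism_def)
  with \<kappa> pb show ?thesis by blast
qed

end

theorem theorem1p2: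
  fixes br :: "'s::euclidean_space \<Rightarrow> 's \<Rightarrow> 's"
    and n a :: "'s set"
    and g :: "'s \<Rightarrow> 's \<Rightarrow> real"
  assumes "lie_algebra br"
    and "solvable_lie br"
    and "is_nilradical br n"
    and "abelian_on br n"
    and "solvsoliton br g"
    and "\<not> ricci_flat br g"
    and "a = orthogonal_complement g n"
  shows "is_arg_max (ricci_pinching br) (\<lambda>h. h \<in> metrics_with_orthogonal br a n) g \<and>
    (\<forall>g'. is_arg_max (ricci_pinching br) (\<lambda>h. h \<in> metrics_with_orthogonal br a n) g' \<longrightarrow>
       solvsoliton br g' \<and>
       (\<exists>c \<phi>. c > 0 \<and> lie_automorphism br \<phi> \<and> (\<forall>x y. g' x y = c * g (\<phi> x) (\<phi> y))))"
proof -
  have ip: "inner_product g" using assms(5) by (simp add: solvsoliton_def)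
  interpret G0: inner_prod g by unfold_locales (rule ip)
  have sub: "subspace n"
    using assms(3) by (auto simp: is_nilradical_def nilpotent_ideal_def lie_ideal_def)
  obtain M where M: "G0.onb n M" using G0.exists_onb[OF sub] by blast
  have Mn: "m \<in> n" if "m \<in> M" for m
    using M that span_base[of m M] by (auto simp: G0.onb_def)
  \<comment> \<open>The \<open>g\<close>-orthogonal projection onto \<open>n\<close>, whose kernel
    is \<open>a\<close>.\<close>
  define p where "p = Blinfun (\<lambda>x. \<Sum>m\<in>M. g x m *\<^sub>R m)"
  have p: "p x = (\<Sum>m\<in>M. g x m *\<^sub>R m)" for x
    unfolding p_def
    by (subst Blinfun_linear)
      (auto intro!: linearI simp: G0.g.add_left G0.g.scaleR_left scaleR_add_left sum.distrib scaleR_sum_right)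
  have p_in: "p x \<in> n" for x
    unfolding p using Mn sub by (intro subspace_sum subspace_scale) auto
  have p_id: "p x = x" if "x \<in> n" for x
    unfolding p by (rule G0.onb_expand[OF M that])
  have gp: "g (p x) y = g x y" if "y \<in> n" for x y
  proof -
    have "g (p x) y = (\<Sum>m\<in>M. g x m * g m y)"
      unfolding p by (simp add: G0.g.sum_left G0.g.scaleR_left)
    also have "\<dots> = (\<Sum>m\<in>M. g y m * g m x)" by (simp only: G0.commute mult.commute)
    also have "\<dots> = g y x" by (rule G0.onb_parseval[OF M that, symmetric])
    finally show ?thesis by (simp only: G0.commute)
  qed
  have a: "a = {x. p x = 0}"
  proof (intro set_eqI iffI)
    fix x assume "x \<in> a"
    then have "g (p x) (p x) = 0" using p_in gp by (auto simp: assms(7) orthogonal_complement_def)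
    then show "x \<in> {x. p x = 0}" by (simp add: G0.eq_0_iff)
  next
    fix x assume "x \<in> {x. p x = 0}"
    then show "x \<in> a" using gp[of _ x] by (auto simp: assms(7) orthogonal_complement_def G0.g.zero_left)
  qed
  have lie: "split_lie br n p"
    by unfold_locales (use assms p_in p_id in auto)
  \<comment> \<open>The same \<open>p\<close> is self-adjoint for every metric with
    \<open>a \<perp> n\<close>, so one projection serves the whole set.\<close>
  have split: "split_metric br n p h" if h: "inner_product h" "orthogonal_wrt h a n" for h
  proof -
    interpret h: inner_prod h by unfold_locales (rule h(1))
    have 0: "h (x - p x) (p y) = 0" "h (p y) (x - p x) = 0" for x y
      using h(2) p_in p_id h.commute[of "p y"]
      by (auto simp: orthogonal_wrt_def a blinfun.diff_right)
    have "h.adj p = p"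
    proof (rule h.adjI)
      fix x y
      have "h (p y) x = h (p y) (p x)" using 0(2)[of y x] by (simp add: h.g.diff_right)
      also have "\<dots> = h y (p x)" using 0(1)[of y x] by (simp add: h.g.diff_left)
      finally show "h (p y) x = h y (p x)" .
    qed
    then show ?thesis
      by (intro split_metric.intro lie split_metric_axioms.intro) unfold_locales
  qed
  have orth: "orthogonal_wrt g a n" by (auto simp: orthogonal_wrt_def assms(7) orthogonal_complement_def)
  interpret G: split_metric br n p g by (rule split[OF ip orth])
  obtain A where A: "G.frame A" using G.exists_frame by blast
  obtain c D where D: "G.Ric = c *\<^sub>R id_blinfun + D" "\<And>x y. D (br x y) = br (D x) y + br x (D y)"
    using G.solvsolitonE[OF assms(5)] by blast
  note sol = G.soliton_structure[OF A D]
  have c: "c < 0" by (rule G.soliton_constant_neg[OF A sol assms(6)])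
  have pair: "soliton_pair br n p g h c" if h: "h \<in> metrics_with_orthogonal br a n" for h
  proof -
    interpret H: split_metric br n p h
      using h by (intro split) (auto simp: metrics_with_orthogonal_def)
    show ?thesis
      using h c sol(1,3) G.normal[OF A sol(2)]
      by unfold_locales (auto simp: metrics_with_orthogonal_def)
  qed
  have g_in: "g \<in> metrics_with_orthogonal br a n"
    using ip orth assms(6) by (simp add: metrics_with_orthogonal_def)
  \<comment> \<open>\<open>g\<close> paired with itself is a legitimate instance, through which
    \<open>K\<close> can be unfolded.\<close>
  have gK: "ricci_pinching br g = soliton_pair.K br p g c"
    unfolding soliton_pair.K_def[OF pair[OF g_in]] by (rule G.pinching_soliton[OF A sol(1,2) c sol(3)])
  have le: "ricci_pinching br h \<le> ricci_pinching br g" if "h \<in> metrics_with_orthogonal br a n" for h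
  proof -
    interpret P: soliton_pair br n p g h c by (rule pair[OF that])
    show ?thesis unfolding gK using P.pinching_bounds(1) P.G'.exists_Q_frame by metis
  qed
  have max: "is_arg_max (ricci_pinching br) (\<lambda>h. h \<in> metrics_with_orthogonal br a n) g"
    using g_in le by (auto simp: is_arg_max_def not_less)
  moreover have "solvsoliton br g' \<and>
       (\<exists>c \<phi>. c > 0 \<and> lie_automorphism br \<phi> \<and> (\<forall>x y. g' x y = c * g (\<phi> x) (\<phi> y)))"
    if g': "is_arg_max (ricci_pinching br) (\<lambda>h. h \<in> metrics_with_orthogonal br a n) g'" for g'
  proof -
    have in': "g' \<in> metrics_with_orthogonal br a n" using g' by (simp add: is_arg_max_def)
    interpret P: soliton_pair br n p g g' c by (rule pair[OF in'])
    have "ricci_pinching br g' = P.K"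
      using le[OF in'] g' g_in unfolding gK[symmetric] by (auto simp: is_arg_max_def not_less intro: antisym)
    from P.maximum_homothetic[OF this] obtain \<kappa> \<phi> where
      \<phi>: "\<kappa> > 0" "lie_automorphism br \<phi>" "\<And>x y. g' x y = \<kappa> * g (\<phi> x) (\<phi> y)" by blast
    have "solvsoliton br g'"
      by (rule solvsoliton_pullback[OF assms(5,1) P.G'.inner_product \<phi>(2,1,3)])
    with \<phi> show ?thesis by blast
  qed
  ultimately show ?thesis by blast
qed

end
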